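(* Let $K\subset\mathbb R^3$ be a knot, let $\mathbb F$ be a field, and let $\epsilon:\mathcal C_K\to\mathbb F$ be an augmentation such that $\epsilon(\mu)\neq 1$. Then a KCH irrep $\rho:\pi_K\to\mathrm{GL}(V)$ (with $V$ an $\mathbb F$-vector space) can be constructed explicitly from $\epsilon$ with the property that $\epsilon_\rho=\epsilon$. Moreover, any KCH irrep that induces $\epsilon$ (that is, any KCH irrep $\rho'$ of $\pi_K$ over $\mathbb F$ with $\epsilon_{\rho'}=\epsilon$) is isomorphic to $(V,\rho)$.
   Context: $K$ is an oriented knot with tubular neighborhood $n(K)$; $\pi_K$ is the fundamental group of the complement $\overline{\mathbb R^3\setminus n(K)}$, based at a point $x$ of $\partial n(K)$. A meridian of $K$ is an element of $\pi_K$ that may be represented by the boundary of an embedded disk meeting $K$ in one interior point. $m\in\pi_K$ is the meridian given by the oriented boundary of the meridian disk of $n(K)$ through $x$, and $\ell\in\pi_K$ is the preferred (Seifert-framed) longitude, so $m\ell=\ell m$. Let $R_0=\mathbb Z[\lambda^{\pm1},\mu^{\pm1}]$. Cord algebra: $\mathcal C_K$ (identified with its standard description in terms of $\pi_K$) is the noncommutative unital $R_0$-algebra generated by symbols $[\gamma]$, $\gamma\in\pi_K$, modulo the relations: (1) $[e]=1-\mu$, where $e$ is the identity of $\pi_K$; (2) $[m\gamma]=[\gamma m]=\mu[\gamma]$ and $[\ell\gamma]=[\gamma\ell]=\lambda[\gamma]$ for all $\gamma\in\pi_K$; (3) $[\gamma_1\gamma_2]-[\gamma_1m\gamma_2]=[\gamma_1][\gamma_2]$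 for all $\gamma_1,\gamma_2\in\pi_K$. An augmentation is a unital ring homomorphism $\epsilon:\mathcal C_K\to\mathbb F$. KCH representation: a homomorphism $\rho:\pi_K\to\mathrm{GL}(V)$, $V$ a finite-dimensional $\mathbb F$-vector space, such that for a meridian $m$ of $K$, $\rho(m)$ is diagonalizable and has eigenvalue $1$ with multiplicity exactly $\dim V-1$. A KCH irrep is a KCH representation that is irreducible. Induced augmentation $\epsilon_\rho$: let $\mu_0\neq1$ be the remaining eigenvalue of $\rho(m)$ and $e_1,\dots,e_d$ a basis of $V$ of eigenvectors of $\rho(m)$ with $\rho(m)e_1=\mu_0e_1$. Since $\ell$ commutes with $m$, $\rho(\ell)e_1=\lambda_0e_1$ for some $\lambda_0\in\mathbb F^*$. Let $\langle\cdot,\cdot\rangle$ be the bilinear form with $\langle e_i,e_j\rangle=\delta_{ij}$. Then $\epsilon_\rho:\mathcal C_K\to\mathbb F$ is the augmentation with $\epsilon_\rho(\mu)=\mu_0$, $\epsilon_\rho(\lambda)=\lambda_0$, $\epsilon_\rho([\gamma])=(1-\mu_0)\langle\rho(\gamma)e_1,e_1\rangle$ for $\gamma\in\pi_K$. One says $\rho$ induces $\epsilon$ if $\epsilon_\rho=\epsilon$. *)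

theory Defs
  imports
    "HOL-Homology.Homology"
    "HOL-Algebra.QuotRing"
    "HOL-Algebra.Bij"
    "HOL-Analysis.Cross3"
    "HOL-Library.Poly_Mapping"
    "HOL-Library.Function_Algebras"
begin

section \<open>Knots and their tubular neighborhoods\<close>

definition smooth_curve :: "(real \<Rightarrow> real^3) \<Rightarrow> bool" where
  "smooth_curve \<kappa> \<longleftrightarrow>
     (\<exists>D. D (0::nat) = \<kappa> \<and> (\<forall>n t. (D n has_vector_derivative D (Suc n) t) (at t)))"

text \<open>An oriented knot is given by a regular 1-periodic parametrization; the knot itself is
  \<open>range \<kappa>\<close>, oriented by increasing parameter.\<close>

definition oriented_knot :: "(real \<Rightarrow> real^3) \<Rightarrow> bool" where
  "oriented_knot \<kappa> \<longleftrightarrow> smooth_curve \<kappa> \<and> (\<forall>t. \<kappa> (t + 1) = \<kappa> t)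
     \<and> (\<forall>t. vector_derivative \<kappa> (at t) \<noteq> 0) \<and> inj_on \<kappa> {0..<1}"

definition unit_tangent :: "(real \<Rightarrow> real^3) \<Rightarrow> real \<Rightarrow> real^3" where
  "unit_tangent \<kappa> t = sgn (vector_derivative \<kappa> (at t))"

text \<open>\<open>n(K)\<close> is the union of the normal disks of radius \<open>r\<close>. The radius is admissible
  if the open normal disk bundle of some strictly larger radius still embeds via the endpoint
  map, so that \<open>n(K)\<close> is a solid torus and its boundary an embedded torus.\<close>

definition tube :: "(real \<Rightarrow> real^3) \<Rightarrow> real \<Rightarrow> (real^3) set" where
  "tube \<kappa> r = {\<kappa> t + v | t v. v \<bullet> unit_tangent \<kappa> t = 0 \<and> norm v \<le> r}"

definition tube_radius :: "(real \<Rightarrow> real^3) \<Rightarrow> real \<Rightarrow> bool" where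
  "tube_radius \<kappa> r \<longleftrightarrow> 0 < r \<and>
     (\<exists>R>r. inj_on (\<lambda>(t, v). \<kappa> t + v)
        {(t, v). 0 \<le> t \<and> t < 1 \<and> v \<bullet> unit_tangent \<kappa> t = 0 \<and> norm v < R})"

definition knot_exterior :: "(real \<Rightarrow> real^3) \<Rightarrow> real \<Rightarrow> (real^3) set" where
  "knot_exterior \<kappa> r = closure (- tube \<kappa> r)"


section \<open>The fundamental group\<close>

definition loop_class :: "'a::topological_space set \<Rightarrow> (real \<Rightarrow> 'a) \<Rightarrow> (real \<Rightarrow> 'a) set" where
  "loop_class S p = {q. homotopic_paths S p q}"

definition fundamental_group ::
    "'a::real_normed_vector set \<Rightarrow> 'a \<Rightarrow> (real \<Rightarrow> 'a) set monoid" where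
  "fundamental_group S x =
     \<lparr>carrier = loop_class S ` {p. path p \<and> path_image p \<subseteq> S \<and> pathstart p = x \<and> pathfinish p = x},
      monoid.mult = (\<lambda>A B. \<Union>p\<in>A. \<Union>q\<in>B. loop_class S (p +++ q)),
      one = loop_class S (linepath x x)\<rparr>"

text \<open>The unit normal vector \<open>v0\<close> at \<open>\<kappa> 0\<close> selects the base point \<open>\<kappa> 0 + r v0\<close> on
  the boundary of \<open>n(K)\<close>; any boundary point arises after shifting the parameter.\<close>

definition unit_normal :: "(real \<Rightarrow> real^3) \<Rightarrow> real \<Rightarrow> real^3 \<Rightarrow> bool" where
  "unit_normal \<kappa> t v \<longleftrightarrow> norm v = 1 \<and> v \<bullet> unit_tangent \<kappa> t = 0"

definition knot_group ::
    "(real \<Rightarrow> real^3) \<Rightarrow> real \<Rightarrow> real^3 \<Rightarrow> (real \<Rightarrow> real^3) set monoid" where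
  "knot_group \<kappa> r v0 = fundamental_group (knot_exterior \<kappa> r) (\<kappa> 0 + r *\<^sub>R v0)"

text \<open>The meridian disk through the base point lies in the normal plane at \<open>\<kappa> 0\<close>, which is
  oriented by the basis \<open>(v0, T \<times> v0)\<close>: with \<open>T\<close> the unit tangent, \<open>(v0, T \<times> v0, T)\<close>
  is a positive basis, so the meridian has linking number \<open>+1\<close> with the knot.\<close>

definition meridian_loop :: "(real \<Rightarrow> real^3) \<Rightarrow> real \<Rightarrow> real^3 \<Rightarrow> real \<Rightarrow> real^3" where
  "meridian_loop \<kappa> r v0 s =
     \<kappa> 0 + r *\<^sub>R (cos (2 * pi * s) *\<^sub>R v0 + sin (2 * pi * s) *\<^sub>R cross3 (unit_tangent \<kappa> 0) v0)"

definition meridian :: "(real \<Rightarrow> real^3) \<Rightarrow> real \<Rightarrow> real^3 \<Rightarrow> (real \<Rightarrow> real^3) set" where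
  "meridian \<kappa> r v0 = loop_class (knot_exterior \<kappa> r) (meridian_loop \<kappa> r v0)"

text \<open>A loop viewed as a singular 1-cycle; the standard 1-simplex consists of the points with
  barycentric coordinates \<open>(1 - s, s)\<close>.\<close>

definition null_homologous :: "'a::topological_space set \<Rightarrow> (real \<Rightarrow> 'a) \<Rightarrow> bool" where
  "null_homologous S p \<longleftrightarrow>
     singular_relboundary 1 (top_of_set S) {}
       (frag_of (restrict (\<lambda>x. p (x 1)) (standard_simplex 1)))"

text \<open>A longitude is the push-off of the knot along a normal framing \<open>\<nu>\<close>; the preferred one is
  null-homologous in the exterior.\<close>

definition preferred_longitude ::
    "(real \<Rightarrow> real^3) \<Rightarrow> real \<Rightarrow> real^3 \<Rightarrow> (real \<Rightarrow> real^3) set \<Rightarrow> bool" where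
  "preferred_longitude \<kappa> r v0 l \<longleftrightarrow>
     (\<exists>\<nu>. continuous_on UNIV \<nu> \<and> (\<forall>t. \<nu> (t + 1) = \<nu> t) \<and> (\<forall>t. unit_normal \<kappa> t (\<nu> t)) \<and> \<nu> 0 = v0
        \<and> null_homologous (knot_exterior \<kappa> r) (\<lambda>t. \<kappa> t + r *\<^sub>R \<nu> t)
        \<and> l = loop_class (knot_exterior \<kappa> r) (\<lambda>t. \<kappa> t + r *\<^sub>R \<nu> t))"


section \<open>The cord algebra\<close>

text \<open>Noncommutative monomials, written additively because the multiplication of
  \<^type>\<open>poly_mapping\<close> is convolution over an additive monoid.\<close>

datatype 'g monomial = Monomial (letters: "'g list")

instantiation monomial :: (type) monoid_add
begin

definition zero_monomial :: "'a monomial" where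
  "zero_monomial = Monomial []"

definition plus_monomial :: "'a monomial \<Rightarrow> 'a monomial \<Rightarrow> 'a monomial" where
  "plus_monomial u w = Monomial (letters u @ letters w)"

instance
  by standard (simp_all add: zero_monomial_def plus_monomial_def)

end

text \<open>The coefficient ring of integral Laurent polynomials in two variables, as the group ring
  of \<open>int \<times> int\<close>.\<close>

type_synonym laurent2 = "(int \<times> int) \<Rightarrow>\<^sub>0 int"

definition lam :: laurent2 where "lam = Poly_Mapping.single (1, 0) 1"

definition mu :: laurent2 where "mu = Poly_Mapping.single (0, 1) 1"

type_synonym 'g free_elt = "'g monomial \<Rightarrow>\<^sub>0 laurent2"

definition scalar :: "laurent2 \<Rightarrow> 'g free_elt" where
  "scalar c = Poly_Mapping.single 0 c"

definition gen :: "'g \<Rightarrow> 'g free_elt" where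
  "gen \<gamma> = Poly_Mapping.single (Monomial [\<gamma>]) 1"

definition free_algebra :: "'g set \<Rightarrow> 'g free_elt ring" where
  "free_algebra X =
     \<lparr>carrier = {p. \<forall>w\<in>Poly_Mapping.keys p. set (letters w) \<subseteq> X},
      monoid.mult = (*), one = 1, zero = 0, add = (+)\<rparr>"

definition cord_relations :: "'g monoid \<Rightarrow> 'g \<Rightarrow> 'g \<Rightarrow> 'g free_elt set" where
  "cord_relations G m l =
     {gen \<one>\<^bsub>G\<^esub> - scalar (1 - mu)}
     \<union> {gen (m \<otimes>\<^bsub>G\<^esub> \<gamma>) - scalar mu * gen \<gamma> | \<gamma>. \<gamma> \<in> carrier G}
     \<union> {gen (\<gamma> \<otimes>\<^bsub>G\<^esub> m) - scalar mu * gen \<gamma> | \<gamma>. \<gamma> \<in> carrier G}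
     \<union> {gen (l \<otimes>\<^bsub>G\<^esub> \<gamma>) - scalar lam * gen \<gamma> | \<gamma>. \<gamma> \<in> carrier G}
     \<union> {gen (\<gamma> \<otimes>\<^bsub>G\<^esub> l) - scalar lam * gen \<gamma> | \<gamma>. \<gamma> \<in> carrier G}
     \<union> {gen (\<gamma>1 \<otimes>\<^bsub>G\<^esub> \<gamma>2) - gen (\<gamma>1 \<otimes>\<^bsub>G\<^esub> m \<otimes>\<^bsub>G\<^esub> \<gamma>2) - gen \<gamma>1 * gen \<gamma>2
          | \<gamma>1 \<gamma>2. \<gamma>1 \<in> carrier G \<and> \<gamma>2 \<in> carrier G}"

definition cord_ideal :: "'g monoid \<Rightarrow> 'g \<Rightarrow> 'g \<Rightarrow> 'g free_elt set" where
  "cord_ideal G m l = Idl\<^bsub>free_algebra (carrier G)\<^esub> (cord_relations G m l)"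

definition cord_algebra :: "'g monoid \<Rightarrow> 'g \<Rightarrow> 'g \<Rightarrow> 'g free_elt set ring" where
  "cord_algebra G m l = free_algebra (carrier G) Quot cord_ideal G m l"

definition cord_proj :: "'g monoid \<Rightarrow> 'g \<Rightarrow> 'g \<Rightarrow> 'g free_elt \<Rightarrow> 'g free_elt set" where
  "cord_proj G m l p = cord_ideal G m l +>\<^bsub>free_algebra (carrier G)\<^esub> p"

abbreviation "cord_gen G m l \<gamma> \<equiv> cord_proj G m l (gen \<gamma>)"
abbreviation "cord_scalar G m l c \<equiv> cord_proj G m l (scalar c)"

definition field_ring :: "'f::field ring" where
  "field_ring = \<lparr>carrier = UNIV, monoid.mult = (*), one = 1, zero = 0, add = (+)\<rparr>"

definition augmentation ::
    "'g monoid \<Rightarrow> 'g \<Rightarrow> 'g \<Rightarrow> ('g free_elt set \<Rightarrow> 'f::field) \<Rightarrow> bool" where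
  "augmentation G m l \<epsilon> \<longleftrightarrow> \<epsilon> \<in> ring_hom (cord_algebra G m l) field_ring"


section \<open>KCH representations\<close>

text \<open>Vector spaces are subspaces \<open>V\<close> of an ambient type with scalar multiplication \<open>sc\<close>.\<close>

definition fin_dim_space :: "('f::field \<Rightarrow> 'v::ab_group_add \<Rightarrow> 'v) \<Rightarrow> 'v set \<Rightarrow> bool" where
  "fin_dim_space sc V \<longleftrightarrow> vector_space sc \<and> (\<exists>B. finite B \<and> V = module.span sc B)"

definition linear_between ::
    "('f \<Rightarrow> 'v::plus \<Rightarrow> 'v) \<Rightarrow> ('f \<Rightarrow> 'w::plus \<Rightarrow> 'w) \<Rightarrow> 'v set \<Rightarrow> ('v \<Rightarrow> 'w) \<Rightarrow> bool" where
  "linear_between s1 s2 V f \<longleftrightarrow>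
     (\<forall>x\<in>V. \<forall>y\<in>V. f (x + y) = f x + f y) \<and> (\<forall>c. \<forall>x\<in>V. f (s1 c x) = s2 c (f x))"

definition GL :: "('f::field \<Rightarrow> 'v::ab_group_add \<Rightarrow> 'v) \<Rightarrow> 'v set \<Rightarrow> ('v \<Rightarrow> 'v) monoid" where
  "GL sc V = BijGroup V \<lparr>carrier := {f \<in> Bij V. linear_between sc sc V f}\<rparr>"

definition representation_on ::
    "'g monoid \<Rightarrow> ('f::field \<Rightarrow> 'v::ab_group_add \<Rightarrow> 'v) \<Rightarrow> 'v set \<Rightarrow> ('g \<Rightarrow> 'v \<Rightarrow> 'v) \<Rightarrow> bool" where
  "representation_on G sc V \<rho> \<longleftrightarrow> fin_dim_space sc V \<and> \<rho> \<in> hom G (GL sc V)"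

definition basis_of :: "('f::field \<Rightarrow> 'v::ab_group_add \<Rightarrow> 'v) \<Rightarrow> 'v set \<Rightarrow> 'v set \<Rightarrow> bool" where
  "basis_of sc V B \<longleftrightarrow> \<not> module.dependent sc B \<and> module.span sc B = V"

definition eigenbasis ::
    "('f::field \<Rightarrow> 'v::ab_group_add \<Rightarrow> 'v) \<Rightarrow> 'v set \<Rightarrow> ('v \<Rightarrow> 'v) \<Rightarrow> 'v set \<Rightarrow> bool" where
  "eigenbasis sc V f B \<longleftrightarrow> basis_of sc V B \<and> (\<forall>b\<in>B. \<exists>c. f b = sc c b)"

text \<open>The condition is imposed on the distinguished meridian \<open>m\<close>; every meridian is conjugate to
  \<open>m\<close> or its inverse, so the choice is immaterial. The multiplicity condition is stated as a sum to
  avoid truncated subtraction.\<close>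

definition KCH_rep ::
    "'g monoid \<Rightarrow> 'g \<Rightarrow> ('f::field \<Rightarrow> 'v::ab_group_add \<Rightarrow> 'v) \<Rightarrow> 'v set \<Rightarrow> ('g \<Rightarrow> 'v \<Rightarrow> 'v) \<Rightarrow> bool" where
  "KCH_rep G m sc V \<rho> \<longleftrightarrow> representation_on G sc V \<rho>
     \<and> (\<exists>B. eigenbasis sc V (\<rho> m) B)
     \<and> vector_space.dim sc {v \<in> V. \<rho> m v = v} + 1 = vector_space.dim sc V"

definition irreducible_rep ::
    "'g monoid \<Rightarrow> ('f::field \<Rightarrow> 'v::ab_group_add \<Rightarrow> 'v) \<Rightarrow> 'v set \<Rightarrow> ('g \<Rightarrow> 'v \<Rightarrow> 'v) \<Rightarrow> bool" where
  "irreducible_rep G sc V \<rho> \<longleftrightarrow> V \<noteq> {0} \<and>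
     (\<forall>W. module.subspace sc W \<and> W \<subseteq> V \<and> (\<forall>g\<in>carrier G. \<rho> g ` W \<subseteq> W) \<longrightarrow> W = {0} \<or> W = V)"

definition KCH_irrep ::
    "'g monoid \<Rightarrow> 'g \<Rightarrow> ('f::field \<Rightarrow> 'v::ab_group_add \<Rightarrow> 'v) \<Rightarrow> 'v set \<Rightarrow> ('g \<Rightarrow> 'v \<Rightarrow> 'v) \<Rightarrow> bool" where
  "KCH_irrep G m sc V \<rho> \<longleftrightarrow> KCH_rep G m sc V \<rho> \<and> irreducible_rep G sc V \<rho>"

definition rep_isomorphic ::
    "'g monoid \<Rightarrow> ('f \<Rightarrow> 'v::plus \<Rightarrow> 'v) \<Rightarrow> 'v set \<Rightarrow> ('g \<Rightarrow> 'v \<Rightarrow> 'v)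
       \<Rightarrow> ('f \<Rightarrow> 'w::plus \<Rightarrow> 'w) \<Rightarrow> 'w set \<Rightarrow> ('g \<Rightarrow> 'w \<Rightarrow> 'w) \<Rightarrow> bool" where
  "rep_isomorphic G s1 V \<rho> s2 W \<sigma> \<longleftrightarrow>
     (\<exists>T. bij_betw T V W \<and> linear_between s1 s2 V T
        \<and> (\<forall>g\<in>carrier G. \<forall>v\<in>V. T (\<rho> g v) = \<sigma> g (T v)))"

definition basis_form ::
    "('f::field \<Rightarrow> 'v::ab_group_add \<Rightarrow> 'v) \<Rightarrow> 'v set \<Rightarrow> 'v \<Rightarrow> 'v \<Rightarrow> 'f" where
  "basis_form sc B v w =
     (\<Sum>b\<in>B. module.representation sc B v b * module.representation sc B w b)"

text \<open>\<open>\<epsilon>\<close> is the augmentation induced by the KCH representation: as a ring homomorphism on the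
  cord algebra it is determined by its values on \<open>\<mu>\<close>, \<open>\<lambda>\<close> and the cords.\<close>

definition induces ::
    "'g monoid \<Rightarrow> 'g \<Rightarrow> 'g \<Rightarrow> ('f::field \<Rightarrow> 'v::ab_group_add \<Rightarrow> 'v) \<Rightarrow> 'v set \<Rightarrow> ('g \<Rightarrow> 'v \<Rightarrow> 'v)
       \<Rightarrow> ('g free_elt set \<Rightarrow> 'f) \<Rightarrow> bool" where
  "induces G m l sc V \<rho> \<epsilon> \<longleftrightarrow>
     (\<exists>B e1 m0 l0. eigenbasis sc V (\<rho> m) B \<and> e1 \<in> B
        \<and> \<rho> m e1 = sc m0 e1 \<and> m0 \<noteq> 1 \<and> \<rho> l e1 = sc l0 e1
        \<and> augmentation G m l \<epsilon>
        \<and> \<epsilon> (cord_scalar G m l mu) = m0 \<and> \<epsilon> (cord_scalar G m l lam) = l0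
        \<and> (\<forall>\<gamma>\<in>carrier G. \<epsilon> (cord_gen G m l \<gamma>) = (1 - m0) * basis_form sc B (\<rho> \<gamma> e1) e1))"


section \<open>The representation constructed from an augmentation\<close>

text \<open>\<open>V\<close> is the column space of the matrix with rows and columns indexed by the group and
  entries \<open>\<epsilon>([\<gamma> g])\<close>; functions are extended by \<open>0\<close> outside the group. The group acts by right
  translation of the argument, which sends the column of \<open>g\<close> to the column of \<open>h g\<close>.\<close>

definition fun_scale :: "'f::field \<Rightarrow> ('g \<Rightarrow> 'f) \<Rightarrow> 'g \<Rightarrow> 'f" where
  "fun_scale c f = (\<lambda>\<gamma>. c * f \<gamma>)"

definition aug_column ::
    "'g monoid \<Rightarrow> 'g \<Rightarrow> 'g \<Rightarrow> ('g free_elt set \<Rightarrow> 'f::field) \<Rightarrow> 'g \<Rightarrow> 'g \<Rightarrow> 'f" where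
  "aug_column G m l \<epsilon> g = (\<lambda>\<gamma>. if \<gamma> \<in> carrier G then \<epsilon> (cord_gen G m l (\<gamma> \<otimes>\<^bsub>G\<^esub> g)) else 0)"

definition aug_space ::
    "'g monoid \<Rightarrow> 'g \<Rightarrow> 'g \<Rightarrow> ('g free_elt set \<Rightarrow> 'f::field) \<Rightarrow> ('g \<Rightarrow> 'f) set" where
  "aug_space G m l \<epsilon> = module.span fun_scale (aug_column G m l \<epsilon> ` carrier G)"

definition aug_rep ::
    "'g monoid \<Rightarrow> 'g \<Rightarrow> 'g \<Rightarrow> ('g free_elt set \<Rightarrow> 'f::field) \<Rightarrow> 'g \<Rightarrow> ('g \<Rightarrow> 'f) \<Rightarrow> 'g \<Rightarrow> 'f" where
  "aug_rep G m l \<epsilon> h =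
     restrict (\<lambda>f \<gamma>. if \<gamma> \<in> carrier G then f (\<gamma> \<otimes>\<^bsub>G\<^esub> h) else 0) (aug_space G m l \<epsilon>)"

end

theory Submission
  imports Defs "HOL-Analysis.Analysis"
begin

text \<open>
  Write \<open>c\<close> for the function \<open>\<gamma> \<mapsto> \<epsilon>([\<gamma>])\<close> on the knot group and let the group act on functions by right
  translation of the argument. The space of the representation is spanned by the translates of
  \<open>c\<close>. Read columnwise, the relation \<open>[\<gamma>\<^sub>1\<gamma>\<^sub>2] - [\<gamma>\<^sub>1m\<gamma>\<^sub>2] = [\<gamma>\<^sub>1][\<gamma>\<^sub>2]\<close> says that the meridian acts as a
  transvection: \<open>\<rho>(m) f = f - f(e) c\<close> for every \<open>f\<close> in the space (\<open>meridian_transvection\<close>). Everything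
  algebraic follows from this formula. Since \<open>c(e) = 1 - \<mu>\<^sub>0\<close> is nonzero, \<open>c\<close> spans the \<open>\<mu>\<^sub>0\<close>-eigenspace
  and the functions vanishing at \<open>e\<close> form the 1-eigenspace, a hyperplane. A nonzero function in an
  invariant subspace has a translate that does not vanish at \<open>e\<close>, so the subspace contains \<open>c\<close> and is
  everything. If another irreducible representation \<open>\<rho>'\<close> induces \<open>\<epsilon>\<close>, the matrix coefficient map
  \<open>v \<mapsto> (\<gamma> \<mapsto> (1 - \<mu>\<^sub>0)\<langle>\<rho>'(\<gamma>)v, e\<^sub>1\<rangle>)\<close> intertwines the two actions, sends \<open>e\<^sub>1\<close> to \<open>c\<close>, and is therefore an
  isomorphism by irreducibility.

  What remains is that the space has finite dimension, and this is where topology enters. A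
  conjugate \<open>gmg\<^sup>-\<^sup>1\<close> moves every function by a multiple of one fixed translate of \<open>c\<close>, so finite
  dimension follows once finitely many conjugates of \<open>m\<close> generate the knot group
  (\<open>knot_group_generated_by_meridians\<close>). This splits into two statements about the complement of
  the knot. The group is finitely generated, because a loop in the exterior can be pushed into a
  ball and then replaced by a polygon whose vertices lie in a finite net. The conjugates of the meridian
  generate, because any homomorphism on the group that kills the meridian also kills every loop
  in a small ball (such a loop either bounds in the ball or winds around one strand of the knot),
  and a loop in the complement can be contracted in space through a sequence of polygons such that
  consecutive ones differ by small loops. The polygons can be kept off the knot, since the union of
  the lines through a given point and the points of a smooth curve is a null set in space.

  Instead of drawing knot diagrams, all homotopies are evaluated by a multiplicative,
  homotopy invariant function on the paths of the complement (locale \<open>holonomy\<close>), so that the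
  combinatorics of polygons becomes a calculation in a group.
\<close>

section \<open>Evaluating an augmentation on cords\<close>

lemma ring_free_algebra: "ring (free_algebra X)"
proof -
  have add: "p + q \<in> carrier (free_algebra X)"
    if "p \<in> carrier (free_algebra X)" "q \<in> carrier (free_algebra X)" for p q
    using that Poly_Mapping.keys_add[of p q] by (auto simp: free_algebra_def)
  have mult: "p * q \<in> carrier (free_algebra X)"
    if "p \<in> carrier (free_algebra X)" "q \<in> carrier (free_algebra X)" for p q
  proof -
    have "set (letters w) \<subseteq> X" if "w \<in> Poly_Mapping.keys (p * q)" for w
    proof -
      obtain u v where "w = u + v" "u \<in> Poly_Mapping.keys p" "v \<in> Poly_Mapping.keys q"
        using \<open>w \<in> _\<close> Poly_Mapping.keys_mult[of p q] by blast
      then show ?thesis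
        using \<open>p \<in> _\<close> \<open>q \<in> _\<close> by (auto simp: free_algebra_def plus_monomial_def)
    qed
    then show ?thesis by (auto simp: free_algebra_def)
  qed
  have one: "1 \<in> carrier (free_algebra X)"
    by (simp add: free_algebra_def zero_monomial_def)
  have zero: "0 \<in> carrier (free_algebra X)"
    by (simp add: free_algebra_def)
  have ops: "p \<oplus>\<^bsub>free_algebra X\<^esub> q = p + q" "p \<otimes>\<^bsub>free_algebra X\<^esub> q = p * q"
    "\<one>\<^bsub>free_algebra X\<^esub> = 1" "\<zero>\<^bsub>free_algebra X\<^esub> = 0" for p q
    by (simp_all add: free_algebra_def)
  have neg: "- p \<in> carrier (free_algebra X)" if "p \<in> carrier (free_algebra X)" for p
    using that by (simp add: free_algebra_def)
  show ?thesis
  proof (rule ringI)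
    show "abelian_group (free_algebra X)"
    proof (rule abelian_groupI, unfold ops)
      show "\<exists>y\<in>carrier (free_algebra X). y + x = 0" if "x \<in> carrier (free_algebra X)" for x
        using neg[OF that] by (intro bexI[of _ "- x"]) simp_all
    qed (simp_all only: add zero ac_simps add_0_left add_0_right)
    show "Group.monoid (free_algebra X)"
      by (rule monoidI, unfold ops) (simp_all only: mult one mult.assoc mult_1_left mult_1_right)
  qed (simp_all only: ops distrib_left distrib_right)
qed

lemma scalar_in_free_algebra: "scalar c \<in> carrier (free_algebra X)"
  by (simp add: scalar_def free_algebra_def zero_monomial_def)

lemma gen_in_free_algebra: "\<gamma> \<in> X \<Longrightarrow> gen \<gamma> \<in> carrier (free_algebra X)"
  by (simp add: gen_def free_algebra_def)

lemma minus_free_algebra: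
  "p \<in> carrier (free_algebra X) \<Longrightarrow> q \<in> carrier (free_algebra X) \<Longrightarrow> p - q \<in> carrier (free_algebra X)"
  using Poly_Mapping.keys_diff[of p q] by (auto simp: free_algebra_def)

lemma mult_free_algebra:
  "p \<in> carrier (free_algebra X) \<Longrightarrow> q \<in> carrier (free_algebra X) \<Longrightarrow> p * q \<in> carrier (free_algebra X)"
  using ring.ring_simprules(5)[OF ring_free_algebra, of p X q] by (simp add: free_algebra_def)

lemma scalar_diff: "scalar (c - d) = scalar c - scalar d"
  by (simp add: scalar_def Poly_Mapping.single_diff)

lemma scalar_one: "scalar 1 = 1"
  by (simp add: scalar_def single_one)

locale cord_augmentation = group G for G :: "'g monoid" (structure) +
  fixes m l :: 'g and \<epsilon> :: "'g free_elt set \<Rightarrow> 'f::field"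
  assumes m_closed [simp]: "m \<in> carrier G" and l_closed [simp]: "l \<in> carrier G"
    and aug: "augmentation G m l \<epsilon>"
    and mu_ne: "\<epsilon> (cord_scalar G m l mu) \<noteq> 1"
begin

definition cord :: "'g \<Rightarrow> 'f" where "cord \<gamma> = \<epsilon> (cord_gen G m l \<gamma>)"
definition mu0 :: 'f where "mu0 = \<epsilon> (cord_scalar G m l mu)"
definition lam0 :: 'f where "lam0 = \<epsilon> (cord_scalar G m l lam)"

lemma mu0_ne: "mu0 \<noteq> 1"
  using mu_ne by (simp add: mu0_def)

lemma cord_relations_subset: "cord_relations G m l \<subseteq> carrier (free_algebra (carrier G))"
  unfolding cord_relations_def
  by (auto intro!: minus_free_algebra mult_free_algebra gen_in_free_algebra scalar_in_free_algebra)

lemma ideal_cord_ideal: "ideal (cord_ideal G m l) (free_algebra (carrier G))"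
  unfolding cord_ideal_def
  by (rule ring.genideal_ideal[OF ring_free_algebra cord_relations_subset])

lemma eval_hom: "(\<lambda>p. \<epsilon> (cord_proj G m l p)) \<in> ring_hom (free_algebra (carrier G)) field_ring"
proof -
  have "\<epsilon> \<circ> (+>\<^bsub>free_algebra (carrier G)\<^esub>) (cord_ideal G m l)
      \<in> ring_hom (free_algebra (carrier G)) field_ring"
    by (rule ring_hom_trans[OF ideal.rcos_ring_hom[OF ideal_cord_ideal]])
       (use aug in \<open>simp add: augmentation_def cord_algebra_def\<close>)
  then show ?thesis by (simp add: cord_proj_def comp_def)
qed

lemma eval_add: "p \<in> carrier (free_algebra (carrier G)) \<Longrightarrow> q \<in> carrier (free_algebra (carrier G)) \<Longrightarrow>
    \<epsilon> (cord_proj G m l (p + q)) = \<epsilon> (cord_proj G m l p) + \<epsilon> (cord_proj G m l q)"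
  using ring_hom_add[OF eval_hom] by (simp add: free_algebra_def field_ring_def)

lemma eval_mult: "p \<in> carrier (free_algebra (carrier G)) \<Longrightarrow> q \<in> carrier (free_algebra (carrier G)) \<Longrightarrow>
    \<epsilon> (cord_proj G m l (p * q)) = \<epsilon> (cord_proj G m l p) * \<epsilon> (cord_proj G m l q)"
  using ring_hom_mult[OF eval_hom] by (simp add: free_algebra_def field_ring_def)

lemma eval_one: "\<epsilon> (cord_proj G m l 1) = 1"
  using ring_hom_one[OF eval_hom] by (simp add: free_algebra_def field_ring_def)

lemma eval_diff: "p \<in> carrier (free_algebra (carrier G)) \<Longrightarrow> q \<in> carrier (free_algebra (carrier G)) \<Longrightarrow>
    \<epsilon> (cord_proj G m l (p - q)) = \<epsilon> (cord_proj G m l p) - \<epsilon> (cord_proj G m l q)"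
  using eval_add[of "p - q" q] minus_free_algebra[of p _ q] by simp

text \<open>An augmentation lives on the quotient ring; the relations enter only through the fact that the
  defining ideal contains them.\<close>

lemma eval_relation:
  assumes "p \<in> cord_relations G m l"
  shows "\<epsilon> (cord_proj G m l p) = 0"
proof -
  let ?R = "free_algebra (carrier G)"
  interpret R: ring ?R by (rule ring_free_algebra)
  interpret I: ideal "cord_ideal G m l" ?R by (rule ideal_cord_ideal)
  have pI: "p \<in> cord_ideal G m l"
    using assms R.genideal_self[OF cord_relations_subset] by (auto simp: cord_ideal_def)
  have "cord_proj G m l p = cord_proj G m l \<zero>\<^bsub>?R\<^esub>"
    unfolding cord_proj_def R.a_rcos_zero[OF ideal_cord_ideal pI]
      R.a_rcos_zero[OF ideal_cord_ideal I.zero_closed] ..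
  moreover have "\<epsilon> (cord_proj G m l 0) = 0"
    using eval_diff[of 1 1] mult_free_algebra R.one_closed by (auto simp: free_algebra_def)
  ultimately show ?thesis by (simp add: free_algebra_def)
qed

lemma cord_one: "cord \<one> = 1 - mu0"
proof -
  have "\<epsilon> (cord_scalar G m l (1 - mu)) = 1 - mu0"
    using eval_diff[OF scalar_in_free_algebra scalar_in_free_algebra, of 1 mu]
    by (simp only: scalar_diff scalar_one eval_one mu0_def)
  moreover have "gen \<one> - scalar (1 - mu) \<in> cord_relations G m l"
    by (simp add: cord_relations_def)
  from eval_relation[OF this] have "cord \<one> - \<epsilon> (cord_scalar G m l (1 - mu)) = 0"
    unfolding cord_def
    by (subst (asm) eval_diff) (simp_all add: gen_in_free_algebra scalar_in_free_algebra)
  ultimately show ?thesis by simp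
qed

lemma m_relation: "\<gamma> \<in> carrier G \<Longrightarrow> gen (\<gamma> \<otimes> m) - scalar mu * gen \<gamma> \<in> cord_relations G m l"
  by (auto simp add: cord_relations_def)

lemma l_relation: "\<gamma> \<in> carrier G \<Longrightarrow> gen (\<gamma> \<otimes> l) - scalar lam * gen \<gamma> \<in> cord_relations G m l"
  by (auto simp add: cord_relations_def)

lemma cord_meridian: "\<gamma> \<in> carrier G \<Longrightarrow> cord (\<gamma> \<otimes> m) = mu0 * cord \<gamma>"
  using eval_relation[OF m_relation, of \<gamma>]
  by (simp add: eval_diff eval_mult mult_free_algebra
      gen_in_free_algebra scalar_in_free_algebra cord_def mu0_def)

lemma cord_longitude: "\<gamma> \<in> carrier G \<Longrightarrow> cord (\<gamma> \<otimes> l) = lam0 * cord \<gamma>"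
  using eval_relation[OF l_relation, of \<gamma>]
  by (simp add: eval_diff eval_mult mult_free_algebra
      gen_in_free_algebra scalar_in_free_algebra cord_def lam0_def)

lemma cord_skein: 
  assumes "\<gamma>1 \<in> carrier G" "\<gamma>2 \<in> carrier G"
  shows "cord (\<gamma>1 \<otimes> \<gamma>2) - cord (\<gamma>1 \<otimes> m \<otimes> \<gamma>2) = cord \<gamma>1 * cord \<gamma>2"
proof -
  have "gen (\<gamma>1 \<otimes> \<gamma>2) - gen (\<gamma>1 \<otimes> m \<otimes> \<gamma>2) - gen \<gamma>1 * gen \<gamma>2 \<in> cord_relations G m l"
    using assms unfolding cord_relations_def by blast
  from eval_relation[OF this] assms show ?thesis
    by (simp add: eval_diff eval_mult mult_free_algebra minus_free_algebra
      gen_in_free_algebra scalar_in_free_algebra cord_def)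
qed

end

section \<open>The representation on translates of the cord function\<close>

lemma vector_space_fun_scale: "vector_space (fun_scale :: 'f::field \<Rightarrow> ('g \<Rightarrow> 'f) \<Rightarrow> 'g \<Rightarrow> 'f)"
  by unfold_locales (auto simp: fun_scale_def fun_eq_iff algebra_simps)

interpretation fs: vector_space "fun_scale :: 'f::field \<Rightarrow> ('g \<Rightarrow> 'f) \<Rightarrow> 'g \<Rightarrow> 'f"
  by (rule vector_space_fun_scale)

text \<open>Pairing with a basis vector reads off its coefficient. The basis is finite because the sum defining the
  form is 0 over an infinite set.\<close>

lemma basis_form_basis_vector:
  fixes sc :: "'f::field \<Rightarrow> 'v::ab_group_add \<Rightarrow> 'v"
  assumes "vector_space sc" "finite B" "\<not> module.dependent sc B" "e \<in> B"
  shows "basis_form sc B v e = module.representation sc B v e"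
proof -
  interpret vector_space sc by fact
  have "basis_form sc B v e = (\<Sum>b\<in>B. if b = e then representation B v e else 0)"
    using assms unfolding basis_form_def
    by (intro sum.cong) (auto simp: representation_basis)
  then show ?thesis using assms by simp
qed

context cord_augmentation
begin

abbreviation "col \<equiv> aug_column G m l \<epsilon>"
abbreviation "V \<equiv> aug_space G m l \<epsilon>"

definition translate :: "'g \<Rightarrow> ('g \<Rightarrow> 'f) \<Rightarrow> 'g \<Rightarrow> 'f" where
  "translate h f = (\<lambda>\<gamma>. if \<gamma> \<in> carrier G then f (\<gamma> \<otimes> h) else 0)"

lemma aug_rep_eq: "aug_rep G m l \<epsilon> h = restrict (translate h) V"
  by (simp add: aug_rep_def translate_def[abs_def])

lemma col_eq: "col g = (\<lambda>\<gamma>. if \<gamma> \<in> carrier G then cord (\<gamma> \<otimes> g) else 0)"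
  by (auto simp: aug_column_def cord_def fun_eq_iff)

lemma col_at_one: "g \<in> carrier G \<Longrightarrow> col g \<one> = cord g"
  by (simp add: col_eq)

lemma translate_add: "translate h (f + g) = translate h f + translate h g"
  by (auto simp: translate_def)

lemma translate_scale: "translate h (fun_scale c f) = fun_scale c (translate h f)"
  by (auto simp: translate_def fun_scale_def)

lemma translate_zero: "translate h 0 = 0"
  by (auto simp: translate_def)

lemma translate_mult:
  assumes "h \<in> carrier G" "k \<in> carrier G"
  shows "translate (h \<otimes> k) f = translate h (translate k f)"
  using assms by (auto simp: translate_def m_assoc)

lemma translate_col: "h \<in> carrier G \<Longrightarrow> g \<in> carrier G \<Longrightarrow> translate h (col g) = col (h \<otimes> g)"
  by (auto simp: translate_def col_eq m_assoc)

lemma col_in_aug_space: "g \<in> carrier G \<Longrightarrow> col g \<in> V"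
  by (auto simp: aug_space_def intro: fs.span_base)

lemma subspace_aug_space: "fs.subspace V"
  by (simp add: aug_space_def)

lemma aug_space_induct [consumes 1, case_names zero add scale col]:
  assumes "f \<in> V" and "P 0" and "\<And>f g. P f \<Longrightarrow> P g \<Longrightarrow> P (f + g)"
    and "\<And>c f. P f \<Longrightarrow> P (fun_scale c f)" and "\<And>g. g \<in> carrier G \<Longrightarrow> P (col g)"
  shows "P f"
  using assms(1) unfolding aug_space_def
  by (rule fs.span_induct[of f _ P]) (use assms in \<open>auto simp: fs.subspace_def\<close>)

lemma aug_space_outside: "f \<in> V \<Longrightarrow> \<gamma> \<notin> carrier G \<Longrightarrow> f \<gamma> = 0"
  by (induction rule: aug_space_induct) (auto simp: fun_scale_def col_eq)

lemma translate_in_aug_space: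
  assumes "f \<in> V" "h \<in> carrier G" shows "translate h f \<in> V"
  using assms(1)
proof (induction rule: aug_space_induct)
  case zero show ?case using fs.subspace_0[OF subspace_aug_space] by (simp only: translate_zero)
next
  case (add f g) then show ?case unfolding translate_add by (rule fs.subspace_add[OF subspace_aug_space])
next
  case (scale c f) then show ?case using subspace_aug_space by (simp add: translate_scale fs.subspace_scale)
next
  case (col g) then show ?case using assms(2) by (simp add: translate_col col_in_aug_space)
qed

lemma translate_one: "f \<in> V \<Longrightarrow> translate \<one> f = f"
  using aug_space_outside by (auto simp: translate_def)

lemma translate_inv:
  assumes "f \<in> V" "h \<in> carrier G"
  shows "translate h (translate (inv h) f) = f" "translate (inv h) (translate h f) = f"
  using assms translate_mult[of h "inv h" f] translate_mult[of "inv h" h f]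
  by (simp_all add: translate_one)

text \<open>Both sides are linear in \<open>f\<close>, and on the column of \<open>g\<close> the identity is the skein relation
  \<open>cord_skein\<close>.\<close>

lemma meridian_transvection:
  assumes "f \<in> V" shows "translate m f = f - fun_scale (f \<one>) (col \<one>)"
proof -
  have "f \<gamma> - translate m f \<gamma> = f \<one> * col \<one> \<gamma>" for \<gamma>
    using assms
  proof (induction arbitrary: \<gamma> rule: aug_space_induct)
    case (col g)
    then show ?case using cord_skein[of \<gamma> g]
      by (auto simp: translate_def col_eq m_assoc)
  next
    case (add f g)
    have "(f + g) \<gamma> - translate m (f + g) \<gamma> = (f \<gamma> - translate m f \<gamma>) + (g \<gamma> - translate m g \<gamma>)"
      by (simp add: translate_add)
    then show ?case by (simp only: add plus_fun_apply[of f g \<one>] distrib_right)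
  next
    case (scale c f)
    have "fun_scale c f \<gamma> - translate m (fun_scale c f) \<gamma> = c * (f \<gamma> - translate m f \<gamma>)"
      unfolding translate_scale by (simp add: fun_scale_def right_diff_distrib)
    then show ?case by (simp only: scale fun_scale_def mult.assoc)
  qed (simp add: translate_zero)
  then have "f - translate m f = fun_scale (f \<one>) (col \<one>)"
    by (simp add: fun_eq_iff fun_scale_def)
  then show ?thesis unfolding diff_eq_eq eq_diff_eq by (simp only: add.commute)
qed

lemma col_one_at_one: "col \<one> \<one> = 1 - mu0"
  by (simp add: col_at_one cord_one)

lemma col_one_ne_zero: "col \<one> \<noteq> 0"
  using col_one_at_one mu0_ne by (metis zero_fun_apply eq_iff_diff_eq_0)

text \<open>Conjugating the transvection by \<open>g\<close> moves its direction to the column of \<open>g\<close>. The inverse of a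
  transvection has the same direction.\<close>

lemma conjugate_meridian_transvection:
  assumes "f \<in> V" "g \<in> carrier G"
  shows "\<exists>c. translate (g \<otimes> m \<otimes> inv g) f = f + fun_scale c (col g)"
    and "\<exists>c. translate (inv (g \<otimes> m \<otimes> inv g)) f = f + fun_scale c (col g)"
proof -
  have upd: "translate g (translate (inv g) f + fun_scale c (col \<one>)) = f + fun_scale c (col g)" for c
    using assms by (simp add: translate_add translate_scale translate_inv translate_col)
  let ?f = "translate (inv g) f"
  have f: "?f \<in> V" using assms by (simp add: translate_in_aug_space)
  have "translate (g \<otimes> m \<otimes> inv g) f = translate g (translate m ?f)"
    using assms by (simp add: translate_mult)
  also have "translate m ?f = ?f + fun_scale (- ?f \<one>) (col \<one>)"
    using meridian_transvection[OF f] by (simp add: fun_scale_def fun_eq_iff)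
  finally show "\<exists>c. translate (g \<otimes> m \<otimes> inv g) f = f + fun_scale c (col g)"
    unfolding upd by (rule exI)
  have "translate (inv (g \<otimes> m \<otimes> inv g)) f = translate g (translate (inv m) ?f)"
    using assms by (simp add: translate_mult inv_mult_group m_assoc)
  also have "translate (inv m) ?f = ?f + fun_scale (translate (inv m) ?f \<one>) (col \<one>)"
  proof -
    have "translate (inv m) ?f \<in> V" using f by (simp add: translate_in_aug_space)
    from meridian_transvection[OF this]
    have "?f = translate (inv m) ?f - fun_scale (translate (inv m) ?f \<one>) (col \<one>)"
      unfolding translate_inv(1)[OF f m_closed] .
    then show ?thesis unfolding eq_diff_eq by (rule sym)
  qed
  finally show "\<exists>c. translate (inv (g \<otimes> m \<otimes> inv g)) f = f + fun_scale c (col g)"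
    unfolding upd by (rule exI)
qed

text \<open>The span of the listed columns contains the column of the identity and is mapped to itself by
  each generator and its inverse, since these change a vector only in the direction of a listed
  column. Hence it contains the whole orbit.\<close>

lemma aug_space_finite_span:
  assumes "S \<subseteq> carrier G" and gen: "carrier G = generate G ((\<lambda>g. g \<otimes> m \<otimes> inv g) ` S)"
  shows "V = fs.span (col ` insert \<one> S)"
proof -
  let ?W = "fs.span (col ` insert \<one> S)"
  have WV: "?W \<subseteq> V"
    using assms(1) by (intro fs.span_minimal subspace_aug_space) (auto simp: col_in_aug_space)
  have inv: "translate h f \<in> ?W" if "h \<in> generate G ((\<lambda>g. g \<otimes> m \<otimes> inv g) ` S)" "f \<in> ?W" for h f
    using that
  proof (induction arbitrary: f rule: generate.induct)
    case one then show ?case using WV by (auto simp: translate_one)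
  next
    case (incl h)
    then obtain g where g: "g \<in> S" "h = g \<otimes> m \<otimes> inv g" by auto
    then obtain c where "translate h f = f + fun_scale c (col g)"
      using conjugate_meridian_transvection(1)[of f g] incl WV assms(1) by auto
    moreover have "col g \<in> ?W" using g by (auto intro: fs.span_base)
    ultimately show ?case using fs.span_add[OF incl(2) fs.span_scale] by presburger
  next
    case (inv h)
    then obtain g where g: "g \<in> S" "h = g \<otimes> m \<otimes> inv g" by auto
    then obtain c where "translate (inv h) f = f + fun_scale c (col g)"
      using conjugate_meridian_transvection(2)[of f g] inv WV assms(1) by auto
    moreover have "col g \<in> ?W" using g by (auto intro: fs.span_base)
    ultimately show ?case using fs.span_add[OF inv(2) fs.span_scale] by presburger
  next
    case (eng h1 h2)
    then show ?case using gen by (simp add: translate_mult)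
  qed
  have "col h \<in> ?W" if "h \<in> carrier G" for h
    using inv[of h "col \<one>"] that gen translate_col[OF that one_closed]
      fs.span_base[of "col \<one>" "col ` insert \<one> S"] by (simp add: that)
  then have "V \<subseteq> ?W"
    unfolding aug_space_def by (intro fs.span_minimal) auto
  with WV show ?thesis by blast
qed

lemma aug_rep_in_GL:
  assumes "h \<in> carrier G"
  shows "aug_rep G m l \<epsilon> h \<in> carrier (GL fun_scale V)"
proof -
  have "bij_betw (translate h) V V"
    using assms
    by (intro bij_betwI[of _ _ _ "translate (inv h)"]) (auto simp: translate_inv translate_in_aug_space)
  then have "aug_rep G m l \<epsilon> h \<in> Bij V"
    by (simp add: Bij_def aug_rep_eq cong: bij_betw_cong)
  moreover have "linear_between fun_scale fun_scale V (aug_rep G m l \<epsilon> h)"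
    using subspace_aug_space
    by (simp add: linear_between_def aug_rep_eq translate_add translate_scale fs.subspace_add fs.subspace_scale)
  ultimately show ?thesis by (simp add: GL_def)
qed

lemma aug_rep_hom: "aug_rep G m l \<epsilon> \<in> hom G (GL fun_scale V)"
proof (rule homI)
  fix h k assume hk: "h \<in> carrier G" "k \<in> carrier G"
  have B: "aug_rep G m l \<epsilon> h \<in> Bij V" "aug_rep G m l \<epsilon> k \<in> Bij V"
    using aug_rep_in_GL hk by (auto simp: GL_def)
  show "aug_rep G m l \<epsilon> (h \<otimes> k) =
      aug_rep G m l \<epsilon> h \<otimes>\<^bsub>GL fun_scale V\<^esub> aug_rep G m l \<epsilon> k"
    using B hk
    by (auto simp: GL_def BijGroup_def compose_def aug_rep_eq fun_eq_iff restrict_def translate_mult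
        translate_in_aug_space)
qed (rule aug_rep_in_GL)

text \<open>If \<open>f\<close> lies in an invariant subspace and \<open>f(\<gamma>) \<noteq> 0\<close>, then \<open>f' = \<rho>(\<gamma>) f\<close> does not vanish at the
  identity, and \<open>f' - \<rho>(m) f'\<close> is a nonzero multiple of the column of the identity.\<close>

lemma irreducible_aug_rep: "irreducible_rep G fun_scale V (aug_rep G m l \<epsilon>)"
  unfolding irreducible_rep_def
proof (intro conjI allI impI)
  show "V \<noteq> {0}"
    using col_one_ne_zero col_in_aug_space[OF one_closed] by auto
  fix W assume "fs.subspace W \<and> W \<subseteq> V \<and> (\<forall>g\<in>carrier G. aug_rep G m l \<epsilon> g ` W \<subseteq> W)"
  then have W: "fs.subspace W" "W \<subseteq> V" and
    inv: "\<And>g f. g \<in> carrier G \<Longrightarrow> f \<in> W \<Longrightarrow> translate g f \<in> W"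
    by (auto simp: aug_rep_eq)
  show "W = {0} \<or> W = V"
  proof (cases "W \<subseteq> {0}")
    case True then show ?thesis using fs.subspace_0[OF W(1)] by auto
  next
    case False
    then obtain f where f: "f \<in> W" "f \<noteq> 0" by auto
    then obtain \<gamma> where \<gamma>: "f \<gamma> \<noteq> 0" by (auto simp: fun_eq_iff)
    with f W have \<gamma>G: "\<gamma> \<in> carrier G" using aug_space_outside by blast
    let ?f = "translate \<gamma> f"
    have f': "?f \<in> W" "?f \<one> \<noteq> 0"
      using inv f \<gamma>G \<gamma> by (auto simp: translate_def)
    have "?f - translate m ?f \<in> W"
      using f' inv W by (simp add: fs.subspace_diff)
    also have "?f - translate m ?f = fun_scale (?f \<one>) (col \<one>)"
      using meridian_transvection f' W by auto
    finally have "fun_scale (1 / ?f \<one>) (fun_scale (?f \<one>) (col \<one>)) \<in> W"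
      using fs.subspace_scale[OF W(1)] by blast
    then have "col \<one> \<in> W" using f' by simp
    then have "col g \<in> W" if "g \<in> carrier G" for g
      using inv[OF that, of "col \<one>"] translate_col[OF that one_closed] that by simp
    then have "V \<subseteq> W" unfolding aug_space_def using W by (intro fs.span_minimal) auto
    then show ?thesis using W by auto
  qed
qed

text \<open>The transvection formula makes evaluation at the identity the projection to the
  \<open>\<mu>\<^sub>0\<close>-eigenline, up to the factor \<open>1 - \<mu>\<^sub>0\<close>: the kernel of the evaluation is fixed by the meridian
  and the column of the identity spans a complement.\<close>

lemma aug_rep_eigenbasis:
  assumes fin: "fin_dim_space fun_scale V"
  obtains C where "finite C" "fs.independent C" "fs.span C = {f \<in> V. f \<one> = 0}"
    "col \<one> \<notin> C" "eigenbasis fun_scale V (aug_rep G m l \<epsilon> m) (insert (col \<one>) C)"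
proof -
  let ?Z = "{f \<in> V. f \<one> = 0}"
  have subZ: "fs.subspace ?Z"
    using subspace_aug_space by (auto simp: fs.subspace_def fun_scale_def)
  obtain C where C: "C \<subseteq> ?Z" "fs.independent C" "?Z \<subseteq> fs.span C"
    using fs.maximal_independent_subset by blast
  have span: "fs.span C = ?Z"
    using C subZ by (simp add: fs.span_minimal subset_antisym)
  obtain B where B: "finite B" "V = fs.span B" using fin by (auto simp: fin_dim_space_def)
  have finC: "finite C"
    using fs.independent_span_bound[OF B(1) C(2)] C(1) B(2) by auto
  have notin: "col \<one> \<notin> fs.span C"
    using span col_one_at_one mu0_ne by auto
  have ind: "fs.independent (insert (col \<one>) C)"
    using notin C(2) fs.independent_insertI by blast
  have "f \<in> fs.span (insert (col \<one>) C)" if f: "f \<in> V" for f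
  proof -
    let ?c = "f \<one> / (1 - mu0)"
    have "f - fun_scale ?c (col \<one>) \<in> ?Z"
      using f subspace_aug_space col_in_aug_space[OF one_closed] col_one_at_one mu0_ne
      by (auto simp: fs.subspace_diff fs.subspace_scale) (simp add: fun_scale_def)
    then show ?thesis using span by (auto simp: fs.span_insert)
  qed
  moreover have "fs.span (insert (col \<one>) C) \<subseteq> V"
    using C(1) col_in_aug_space[OF one_closed] by (intro fs.span_minimal subspace_aug_space) auto
  ultimately have "basis_of fun_scale V (insert (col \<one>) C)"
    using ind by (auto simp: basis_of_def)
  moreover have "aug_rep G m l \<epsilon> m (col \<one>) = fun_scale mu0 (col \<one>)"
    using meridian_transvection[of "col \<one>"] col_in_aug_space[OF one_closed] col_one_at_one
    by (simp add: aug_rep_eq fs.scale_left_diff_distrib)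
  moreover have "aug_rep G m l \<epsilon> m b = fun_scale 1 b" if "b \<in> C" for b
    using that C(1) meridian_transvection[of b] by (auto simp: aug_rep_eq)
  ultimately have "eigenbasis fun_scale V (aug_rep G m l \<epsilon> m) (insert (col \<one>) C)"
    unfolding eigenbasis_def by blast
  with that finC C(2) span notin show ?thesis
    using fs.span_base by blast
qed

lemma KCH_aug_rep:
  assumes fin: "fin_dim_space fun_scale V"
  shows "KCH_rep G m fun_scale V (aug_rep G m l \<epsilon>)"
proof -
  obtain C where C: "finite C" "fs.independent C" "fs.span C = {f \<in> V. f \<one> = 0}"
    "col \<one> \<notin> C" and eb: "eigenbasis fun_scale V (aug_rep G m l \<epsilon> m) (insert (col \<one>) C)"
    using aug_rep_eigenbasis[OF fin] by blast
  have fix_iff: "translate m f = f \<longleftrightarrow> f \<one> = 0" if "f \<in> V" for f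
    using meridian_transvection[OF that] col_one_ne_zero by simp
  have "fs.dim {f \<in> V. aug_rep G m l \<epsilon> m f = f} = card C"
  proof -
    have "{f \<in> V. aug_rep G m l \<epsilon> m f = f} = fs.span C"
      using fix_iff C(3) by (auto simp: aug_rep_eq)
    then show ?thesis using C(2) by (simp add: fs.dim_eq_card_independent)
  qed
  moreover have "fs.dim V = card (insert (col \<one>) C)"
    using eb fs.dim_span_eq_card_independent[of "insert (col \<one>) C"]
    by (auto simp: eigenbasis_def basis_of_def)
  ultimately show ?thesis
    using eb fin aug_rep_hom C(1,4) by (auto simp: KCH_rep_def representation_on_def)
qed

lemma aug_rep_induces:
  assumes fin: "fin_dim_space fun_scale V"
  shows "induces G m l fun_scale V (aug_rep G m l \<epsilon>) \<epsilon>"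
proof -
  obtain C where C: "finite C" "fs.independent C" "fs.span C = {f \<in> V. f \<one> = 0}"
    "col \<one> \<notin> C" and eb: "eigenbasis fun_scale V (aug_rep G m l \<epsilon> m) (insert (col \<one>) C)"
    using aug_rep_eigenbasis[OF fin] by blast
  let ?B = "insert (col \<one>) C"
  have ind: "fs.independent ?B" and span: "fs.span ?B = V"
    using eb by (auto simp: eigenbasis_def basis_of_def)
  have oneV: "col \<one> \<in> V" by (simp add: col_in_aug_space)
  have form: "(1 - mu0) * basis_form fun_scale ?B f (col \<one>) = f \<one>" if f: "f \<in> V" for f
  proof -
    let ?c = "f \<one> / (1 - mu0)"
    let ?z = "f - fun_scale ?c (col \<one>)"
    have z: "?z \<in> fs.span C"
      unfolding C(3) using f oneV subspace_aug_space col_one_at_one mu0_ne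
      by (auto simp: fs.subspace_diff fs.subspace_scale) (simp add: fun_scale_def)
    then have "fs.representation ?B ?z (col \<one>) = 0"
      using fs.representation_extend[OF ind z subset_insertI] C(4) fs.representation_ne_zero by metis
    moreover have "fs.representation ?B ?z (col \<one>)
        = fs.representation ?B f (col \<one>) - ?c * fs.representation ?B (col \<one>) (col \<one>)"
      using f oneV
      by (subst fs.representation_diff[OF ind]) (simp_all only: span fs.representation_scale[OF ind]
          fs.subspace_scale[OF subspace_aug_space])
    ultimately have "fs.representation ?B f (col \<one>) = ?c"
      using ind by (simp add: fs.representation_basis)
    then show ?thesis
      using basis_form_basis_vector[OF vector_space_fun_scale _ ind] C(1) mu0_ne by simp
  qed
  have "aug_rep G m l \<epsilon> m (col \<one>) = fun_scale mu0 (col \<one>)"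
    using oneV cord_meridian by (auto simp: aug_rep_eq translate_col) (auto simp: col_eq fun_scale_def fun_eq_iff)
  moreover have "aug_rep G m l \<epsilon> l (col \<one>) = fun_scale lam0 (col \<one>)"
    using oneV cord_longitude by (auto simp: aug_rep_eq translate_col) (auto simp: col_eq fun_scale_def fun_eq_iff)
  moreover have "\<epsilon> (cord_gen G m l \<gamma>) = (1 - mu0) * basis_form fun_scale ?B (aug_rep G m l \<epsilon> \<gamma> (col \<one>)) (col \<one>)"
    if "\<gamma> \<in> carrier G" for \<gamma>
    using that oneV form[of "col \<gamma>"] by (simp add: aug_rep_eq translate_col col_in_aug_space col_at_one cord_def)
  ultimately show ?thesis
    unfolding induces_def using eb aug mu0_ne by (fastforce simp: mu0_def lam0_def)
qed

text \<open>The isomorphism sends \<open>v\<close> to its matrix coefficient \<open>\<gamma> \<mapsto> (1 - \<mu>\<^sub>0)\<langle>\<rho>(\<gamma>)v, e\<rangle>\<close>. It turns the action on \<open>v\<close>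
  into right translation, and because the given representation induces the augmentation, it sends
  the orbit of \<open>e\<close> to the columns. The orbit of \<open>e\<close> spans and the kernel is trivial, both by irreducibility.\<close>

lemma inducing_irrep_isomorphic:
  fixes sc :: "'f \<Rightarrow> 'v::ab_group_add \<Rightarrow> 'v"
  assumes rep: "KCH_irrep G m sc U \<rho>" and ind: "induces G m l sc U \<rho> \<epsilon>"
  shows "rep_isomorphic G sc U \<rho> fun_scale V (aug_rep G m l \<epsilon>)"
proof -
  have vs: "vector_space sc" and fin: "\<exists>B. finite B \<and> U = module.span sc B"
    and hom: "\<rho> \<in> hom G (GL sc U)" and irr: "irreducible_rep G sc U \<rho>"
    using rep by (auto simp: KCH_irrep_def KCH_rep_def representation_on_def fin_dim_space_def)
  interpret U: vector_space sc by (rule vs)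
  have irrD: "W = {0} \<or> W = U"
    if "U.subspace W" "W \<subseteq> U" "\<And>g w. g \<in> carrier G \<Longrightarrow> w \<in> W \<Longrightarrow> \<rho> g w \<in> W" for W
  proof -
    have "\<forall>g\<in>carrier G. \<rho> g ` W \<subseteq> W" using that(3) by blast
    with that(1,2) have "U.subspace W \<and> W \<subseteq> U \<and> (\<forall>g\<in>carrier G. \<rho> g ` W \<subseteq> W)" by (intro conjI)
    with irr show ?thesis unfolding irreducible_rep_def by (elim conjE allE impE, intro conjI)
  qed
  have subU: "U.subspace U" using fin by auto
  have GL: "\<rho> g \<in> Bij U" "linear_between sc sc U (\<rho> g)" if "g \<in> carrier G" for g
    using hom_in_carrier[OF hom that] by (simp_all add: GL_def)
  have inU: "\<rho> g v \<in> U" if "g \<in> carrier G" "v \<in> U" for g v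
    using Bij_imp_funcset[OF GL(1)[OF that(1)]] that(2) by (rule funcset_mem)
  have add: "\<rho> g (v + w) = \<rho> g v + \<rho> g w" if "g \<in> carrier G" "v \<in> U" "w \<in> U" for g v w
    using GL(2)[OF that(1)] that(2,3) unfolding linear_between_def by blast
  have scale: "\<rho> g (sc c v) = sc c (\<rho> g v)" if "g \<in> carrier G" "v \<in> U" for g v c
    using GL(2)[OF that(1)] that(2) unfolding linear_between_def by blast
  have mult: "\<rho> (g \<otimes> h) v = \<rho> g (\<rho> h v)" if "g \<in> carrier G" "h \<in> carrier G" "v \<in> U" for g h v
    using GL(1)[OF that(1)] GL(1)[OF that(2)] that(3) hom_mult[OF hom that(1,2)]
    by (simp add: GL_def BijGroup_def compose_def)
  obtain B e m0 where B: "U.independent B" "U.span B = U" "e \<in> B"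
    and cordB: "\<And>\<gamma>. \<gamma> \<in> carrier G \<Longrightarrow> cord \<gamma> = (1 - m0) * basis_form sc B (\<rho> \<gamma> e) e"
    using ind unfolding induces_def eigenbasis_def basis_of_def cord_def by metis
  have finB: "finite B"
    using fin B U.independent_span_bound by (metis U.span_superset)
  have eU: "e \<in> U" using B U.span_base by blast
  let ?x = "\<lambda>v. U.representation B v e"
  have x_add: "?x (v + w) = ?x v + ?x w" if "v \<in> U" "w \<in> U" for v w
    using B that by (auto simp: U.representation_add)
  have x_scale: "?x (sc c v) = c * ?x v" if "v \<in> U" for v c
    using B that by (auto simp: U.representation_scale)
  define T where "T = (\<lambda>v \<gamma>. if \<gamma> \<in> carrier G then (1 - m0) * ?x (\<rho> \<gamma> v) else 0)"
  have Tadd: "T (v + w) = T v + T w" if "v \<in> U" "w \<in> U" for v w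
    using that by (auto simp: T_def fun_eq_iff add x_add inU distrib_left)
  have Tscale: "T (sc c v) = fun_scale c (T v)" if "v \<in> U" for v c
    using that by (auto simp: T_def fun_eq_iff fun_scale_def scale x_scale inU)
  have T_equiv: "T (\<rho> h v) = translate h (T v)" if "h \<in> carrier G" "v \<in> U" for h v
    using that by (auto simp: T_def translate_def fun_eq_iff mult)
  have "T e = col \<one>"
    using cordB basis_form_basis_vector[OF vs finB B(1,3)] by (auto simp: T_def col_eq fun_eq_iff)
  then have T_orbit: "T (\<rho> g e) = col g" if "g \<in> carrier G" for g
    using that eU translate_col[OF that one_closed] by (simp add: T_equiv)
  have Tzero: "T 0 = 0"
    using Tscale[OF eU, of 0] by (simp add: fun_scale_def fun_eq_iff)

  \<comment> \<open>The vector e is cyclic, because the span of its orbit is a nonzero invariant subspace.\<close>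
  let ?O = "U.span ((\<lambda>g. \<rho> g e) ` carrier G)"
  have OU: "?O \<subseteq> U"
    using inU eU by (intro U.span_minimal subU) auto
  have O_inv: "\<rho> h v \<in> ?O" if h: "h \<in> carrier G" and "v \<in> ?O" for h v
  proof -
    have "?O \<subseteq> {v \<in> ?O. \<rho> h v \<in> ?O}"
    proof (rule U.span_minimal)
      show "U.subspace {v \<in> ?O. \<rho> h v \<in> ?O}"
      proof (rule U.subspaceI)
        have "\<rho> h 0 = 0"
          using scale[OF h eU, of 0] by simp
        then show "0 \<in> {v \<in> ?O. \<rho> h v \<in> ?O}" by (simp add: U.span_zero)
      qed (use OU add[OF h] scale[OF h] in \<open>auto simp: subset_iff U.span_add U.span_scale\<close>)
      have "\<rho> h (\<rho> g e) \<in> ?O" if "g \<in> carrier G" for g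
        using mult[OF h that eU, symmetric] h that by (auto intro!: U.span_base)
      then show "(\<lambda>g. \<rho> g e) ` carrier G \<subseteq> {v \<in> ?O. \<rho> h v \<in> ?O}"
        by (auto intro: U.span_base)
    qed
    then show ?thesis using \<open>v \<in> ?O\<close> by blast
  qed
  have "?O \<noteq> {0}"
  proof
    assume "?O = {0}"
    moreover have "\<rho> \<one> e \<in> ?O" by (auto intro: U.span_base)
    ultimately have "\<rho> \<one> e = 0" by blast
    then have "col \<one> = 0" using T_orbit[OF one_closed] Tzero by simp
    then show False using col_one_ne_zero by simp
  qed
  with irrD[OF U.subspace_span OU O_inv] have O_eq: "?O = U" by simp

  have TV: "T v \<in> V" if "v \<in> U" for v
  proof -
    have "?O \<subseteq> {v \<in> U. T v \<in> V}"
    proof (rule U.span_minimal)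
      show "U.subspace {v \<in> U. T v \<in> V}"
      proof (rule U.subspaceI)
        show "0 \<in> {v \<in> U. T v \<in> V}"
          using U.subspace_0[OF subU] fs.subspace_0[OF subspace_aug_space] Tzero by simp
      next
        fix v w assume "v \<in> {v \<in> U. T v \<in> V}" "w \<in> {v \<in> U. T v \<in> V}"
        then show "v + w \<in> {v \<in> U. T v \<in> V}"
          using U.subspace_add[OF subU] fs.subspace_add[OF subspace_aug_space] Tadd by simp
      next
        fix c v assume "v \<in> {v \<in> U. T v \<in> V}"
        then show "sc c v \<in> {v \<in> U. T v \<in> V}"
          using U.subspace_scale[OF subU] fs.subspace_scale[OF subspace_aug_space] Tscale by simp
      qed
    qed (use T_orbit inU eU col_in_aug_space in auto)
    then show ?thesis using that O_eq by blast
  qed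
  have surj: "V \<subseteq> T ` U"
  proof
    fix f assume "f \<in> V"
    then show "f \<in> T ` U"
    proof (induction rule: aug_space_induct)
      case zero
      show ?case using Tzero U.subspace_0[OF subU] by (intro image_eqI[of _ _ 0]) simp_all
    next
      case (add f g)
      then obtain v w where "v \<in> U" "w \<in> U" "f = T v" "g = T w" by blast
      then show ?case
        using Tadd[of v w] U.subspace_add[OF subU] by (intro image_eqI[of _ _ "v + w"]) simp_all
    next
      case (scale c f)
      then obtain v where "v \<in> U" "f = T v" by blast
      then show ?case
        using Tscale[of v c] U.subspace_scale[OF subU] by (intro image_eqI[of _ _ "sc c v"]) simp_all
    next
      case (col g)
      then show ?case using T_orbit inU eU by (intro image_eqI[of _ _ "\<rho> g e"]) simp_all
    qed
  qed
  have kernel: "{v \<in> U. T v = 0} = {0}" (is "?N = _")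
  proof -
    have "U.subspace ?N"
    proof (rule U.subspaceI)
      show "0 \<in> ?N"
        using U.subspace_0[OF subU] Tzero by simp
    next
      fix v w assume "v \<in> ?N" "w \<in> ?N"
      then show "v + w \<in> ?N"
        using U.subspace_add[OF subU] Tadd[of v w] by auto
    next
      fix c v assume "v \<in> ?N"
      then show "sc c v \<in> ?N"
        using U.subspace_scale[OF subU] Tscale[of v c] by auto
    qed
    then have "?N = {0} \<or> ?N = U"
    proof (rule irrD)
      fix g w assume "g \<in> carrier G" "w \<in> ?N"
      then show "\<rho> g w \<in> ?N" using inU T_equiv[of g w] translate_zero by simp
    qed auto
    moreover have "e \<notin> ?N"
      using \<open>T e = col \<one>\<close> col_one_ne_zero by simp
    ultimately show ?thesis using eU by blast
  qed
  have "inj_on T U"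
  proof (rule inj_onI)
    fix v w assume vw: "v \<in> U" "w \<in> U" "T v = T w"
    then have "v - w \<in> U" using U.subspace_diff[OF subU] by blast
    moreover from this have "T v = T (v - w) + T w"
      using Tadd[of "v - w" w] vw(2) unfolding diff_add_cancel by blast
    then have "T (v - w) = 0" unfolding vw(3) add_cancel_right_left .
    ultimately have "v - w = 0" using kernel by blast
    then show "v = w" by simp
  qed
  then have "bij_betw T U V"
    using surj TV unfolding bij_betw_def by blast
  moreover have "linear_between sc fun_scale U T"
    unfolding linear_between_def using Tadd Tscale by blast
  moreover have "T (\<rho> g v) = aug_rep G m l \<epsilon> g (T v)" if "g \<in> carrier G" "v \<in> U" for g v
    using T_equiv[OF that] TV[OF that(2)] by (simp only: aug_rep_eq restrict_apply if_True)
  ultimately show ?thesis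
    unfolding rep_isomorphic_def by blast
qed

theorem augmentation_to_irrep:
  assumes "finite S" "S \<subseteq> carrier G" "carrier G = generate G ((\<lambda>g. g \<otimes> m \<otimes> inv g) ` S)"
  shows "KCH_irrep G m fun_scale V (aug_rep G m l \<epsilon>)"
    and "induces G m l fun_scale V (aug_rep G m l \<epsilon>) \<epsilon>"
proof -
  have "fin_dim_space fun_scale V"
    unfolding fin_dim_space_def
    using aug_space_finite_span[OF assms(2,3)] assms(1) vector_space_fun_scale
    by (metis finite_imageI finite_insert)
  then show "KCH_irrep G m fun_scale V (aug_rep G m l \<epsilon>)"
    and "induces G m l fun_scale V (aug_rep G m l \<epsilon>) \<epsilon>"
    by (simp_all add: KCH_irrep_def KCH_aug_rep irreducible_aug_rep aug_rep_induces)
qed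

end

section \<open>The fundamental group\<close>

definition path_in :: "'a::topological_space set \<Rightarrow> 'a \<Rightarrow> 'a \<Rightarrow> (real \<Rightarrow> 'a) \<Rightarrow> bool" where
  "path_in S a b p \<longleftrightarrow> path p \<and> path_image p \<subseteq> S \<and> pathstart p = a \<and> pathfinish p = b"

lemma path_in_join: "path_in S a b p \<Longrightarrow> path_in S b c q \<Longrightarrow> path_in S a c (p +++ q)"
  by (simp add: path_in_def subset_path_image_join)

lemma path_in_reverse: "path_in S a b p \<Longrightarrow> path_in S b a (reversepath p)"
  by (simp add: path_in_def)

lemma path_in_linepath: "closed_segment a b \<subseteq> S \<Longrightarrow> path_in S a b (linepath a b)"
  by (simp add: path_in_def)

lemma path_in_const: "a \<in> S \<Longrightarrow> path_in S a a (linepath a a)"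
  by (simp add: path_in_def)

lemma path_in_mono: "path_in S a b p \<Longrightarrow> S \<subseteq> T \<Longrightarrow> path_in T a b p"
  by (auto simp: path_in_def)

lemma path_in_image:
  "path_in S a b p \<Longrightarrow> continuous_on S h \<Longrightarrow> h \<in> S \<rightarrow> T \<Longrightarrow> path_in T (h a) (h b) (h \<circ> p)"
  by (auto simp: path_in_def pathstart_compose pathfinish_compose path_image_compose
      intro!: path_continuous_image continuous_on_subset[of S h])

lemma path_in_endpoints: "path_in S a b p \<Longrightarrow> a \<in> S \<and> b \<in> S"
  by (auto simp: path_in_def)

lemma homotopic_paths_assoc':
  assumes "path_in S a b p" "path_in S b c q" "path_in S c d r"
  shows "homotopic_paths S ((p +++ q) +++ r) (p +++ (q +++ r))"
  using assms homotopic_paths_assoc[of p S q r] homotopic_paths_sym by (auto simp: path_in_def)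

lemma homotopic_paths_join':
  assumes "homotopic_paths S p p'" "homotopic_paths S q q'" "path_in S a b p" "path_in S b c q"
  shows "homotopic_paths S (p +++ q) (p' +++ q')"
  using assms by (auto simp: path_in_def intro: homotopic_paths_join)

lemma homotopic_paths_refl': "path_in S a b p \<Longrightarrow> homotopic_paths S p p"
  by (simp add: path_in_def)

lemma homotopic_paths_convex:
  fixes p q :: "real \<Rightarrow> 'a::real_normed_vector"
  assumes "path_in S a b p" "path_in S a b q" "convex S"
  shows "homotopic_paths S p q"
proof (rule homotopic_paths_linear)
  fix t :: real assume "t \<in> {0..1}"
  then have "p t \<in> S" "q t \<in> S" using assms by (auto simp: path_in_def path_image_def)
  then show "closed_segment (p t) (q t) \<subseteq> S"
    using assms(3) by (simp add: closed_segment_subset)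
qed (use assms in \<open>auto simp: path_in_def\<close>)

lemma loop_class_eq:
  assumes "homotopic_paths S p q" shows "loop_class S p = loop_class S q"
  using assms homotopic_paths_trans homotopic_paths_sym unfolding loop_class_def by blast

lemma carrier_fundamental_group:
  "carrier (fundamental_group S x) = {loop_class S p | p. path_in S x x p}"
  by (auto simp: fundamental_group_def path_in_def)

lemma loop_class_in_group: "path_in S x x p \<Longrightarrow> loop_class S p \<in> carrier (fundamental_group S x)"
  by (auto simp: carrier_fundamental_group)

lemma loop_class_mult:
  assumes "path_in S x x p" "path_in S x x q"
  shows "loop_class S p \<otimes>\<^bsub>fundamental_group S x\<^esub> loop_class S q = loop_class S (p +++ q)"
proof -
  have eq: "loop_class S (p' +++ q') = loop_class S (p +++ q)"
    if "p' \<in> loop_class S p" "q' \<in> loop_class S q" for p' q'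
    using that homotopic_paths_join'[OF _ _ assms, of p' q']
    unfolding loop_class_def mem_Collect_eq by (intro loop_class_eq[symmetric, unfolded loop_class_def])
  have mem: "p \<in> loop_class S p" "q \<in> loop_class S q"
    using assms by (simp_all add: loop_class_def path_in_def)
  have "loop_class S p \<otimes>\<^bsub>fundamental_group S x\<^esub> loop_class S q
      = (\<Union>p'\<in>loop_class S p. \<Union>q'\<in>loop_class S q. loop_class S (p' +++ q'))"
    by (simp add: fundamental_group_def)
  also have "\<dots> = (\<Union>p'\<in>loop_class S p. \<Union>q'\<in>loop_class S q. loop_class S (p +++ q))"
    by (intro SUP_cong refl eq)
  also have "\<dots> = loop_class S (p +++ q)"
    using mem by (auto simp only: UN_iff)
  finally show ?thesis .
qed

lemma one_fundamental_group: "\<one>\<^bsub>fundamental_group S x\<^esub> = loop_class S (linepath x x)"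
  by (simp add: fundamental_group_def)

lemma group_fundamental_group:
  assumes "x \<in> S" shows "group (fundamental_group S x)"
proof (rule groupI)
  let ?G = "fundamental_group S x"
  have const: "path_in S x x (linepath x x)" using assms by (rule path_in_const)
  show "\<one>\<^bsub>?G\<^esub> \<in> carrier ?G"
    by (simp add: one_fundamental_group loop_class_in_group const)
  fix A assume "A \<in> carrier ?G"
  then obtain p where p: "path_in S x x p" "A = loop_class S p" by (auto simp: carrier_fundamental_group)
  show "\<one>\<^bsub>?G\<^esub> \<otimes>\<^bsub>?G\<^esub> A = A"
    using p(1) unfolding p(2) one_fundamental_group loop_class_mult[OF const p(1)]
    by (intro loop_class_eq homotopic_paths_lid') (auto simp: path_in_def)
  have "loop_class S (reversepath p) \<otimes>\<^bsub>?G\<^esub> A = \<one>\<^bsub>?G\<^esub>"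
    using p(1) homotopic_paths_linv[of p S]
    unfolding p(2) one_fundamental_group loop_class_mult[OF path_in_reverse[OF p(1)] p(1)]
    by (intro loop_class_eq) (auto simp: path_in_def)
  then show "\<exists>B\<in>carrier ?G. B \<otimes>\<^bsub>?G\<^esub> A = \<one>\<^bsub>?G\<^esub>"
    using loop_class_in_group[OF path_in_reverse[OF p(1)]] by blast
  fix B assume "B \<in> carrier ?G"
  then obtain q where q: "path_in S x x q" "B = loop_class S q" by (auto simp: carrier_fundamental_group)
  show "A \<otimes>\<^bsub>?G\<^esub> B \<in> carrier ?G"
    unfolding p(2) q(2) loop_class_mult[OF p(1) q(1)]
    by (rule loop_class_in_group[OF path_in_join[OF p(1) q(1)]])
  fix C assume "C \<in> carrier ?G"
  then obtain r where r: "path_in S x x r" "C = loop_class S r" by (auto simp: carrier_fundamental_group)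
  show "A \<otimes>\<^bsub>?G\<^esub> B \<otimes>\<^bsub>?G\<^esub> C = A \<otimes>\<^bsub>?G\<^esub> (B \<otimes>\<^bsub>?G\<^esub> C)"
    unfolding p(2) q(2) r(2) loop_class_mult[OF p(1) q(1)] loop_class_mult[OF q(1) r(1)]
      loop_class_mult[OF path_in_join[OF p(1) q(1)] r(1)] loop_class_mult[OF p(1) path_in_join[OF q(1) r(1)]]
    by (rule loop_class_eq[OF homotopic_paths_assoc'[OF p(1) q(1) r(1)]])
qed

section \<open>Holonomies\<close>

text \<open>A homomorphism from the fundamental groupoid to a group, presented as a function on paths. Both
  the fundamental group itself and its quotients by normal subgroups arise as targets.\<close>

locale holonomy = group Q for Q :: "('q, 'm) monoid_scheme" (structure) +
  fixes S :: "'a::euclidean_space set" and \<phi> :: "(real \<Rightarrow> 'a) \<Rightarrow> 'q"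
  assumes closed: "path_in S a b p \<Longrightarrow> \<phi> p \<in> carrier Q"
    and join: "path_in S a b p \<Longrightarrow> path_in S b c q \<Longrightarrow> \<phi> (p +++ q) = \<phi> p \<otimes> \<phi> q"
    and homotopic: "homotopic_paths S p q \<Longrightarrow> \<phi> p = \<phi> q"
begin

lemma const: assumes "a \<in> S" shows "\<phi> (linepath a a) = \<one>"
proof -
  have p: "path_in S a a (linepath a a)" using assms by (rule path_in_const)
  have "\<phi> (linepath a a) \<otimes> \<phi> (linepath a a) = \<phi> (linepath a a)"
    using p unfolding join[OF p p, symmetric]
    by (intro homotopic homotopic_paths_lid') (auto simp: path_in_def)
  then show ?thesis using closed[OF p] by (simp add: r_cancel_one')
qed

lemma reverse: assumes "path_in S a b p" shows "\<phi> (reversepath p) = inv (\<phi> p)"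
proof -
  have "\<phi> (reversepath p) \<otimes> \<phi> p = \<phi> (linepath b b)"
    using assms homotopic_paths_linv[of p S] unfolding join[OF path_in_reverse[OF assms] assms, symmetric]
    by (intro homotopic) (auto simp: path_in_def)
  then show ?thesis
    using const closed[OF assms] closed[OF path_in_reverse[OF assms]] path_in_endpoints[OF assms]
    by (simp add: inv_equality)
qed

definition trivial_on :: "'a set \<Rightarrow> bool" where
  "trivial_on D \<longleftrightarrow> (\<forall>a p. path_in (S \<inter> D) a a p \<longrightarrow> \<phi> p = \<one>)"

lemma trivial_on_convex: assumes "convex D" "D \<subseteq> S" shows "trivial_on D"
  unfolding trivial_on_def
proof (intro allI impI)
  fix a p assume "path_in (S \<inter> D) a a p"
  then have p: "path_in D a a p" by (rule path_in_mono) auto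
  have a: "a \<in> D" using path_in_endpoints[OF p] by simp
  have "homotopic_paths D p (linepath a a)"
    by (rule homotopic_paths_convex[OF p path_in_const[OF a] assms(1)])
  then have "\<phi> p = \<phi> (linepath a a)"
    using assms(2) by (intro homotopic) (rule homotopic_paths_subset)
  then show "\<phi> p = \<one>" using const a assms(2) by auto
qed

lemma trivial_on_unique:
  assumes "trivial_on D" "path_in (S \<inter> D) a b p" "path_in (S \<inter> D) a b q"
  shows "\<phi> p = \<phi> q"
proof -
  have pq: "path_in S a b p" "path_in S a b q" using assms(2,3) by (auto intro: path_in_mono)
  have "\<phi> (p +++ reversepath q) = \<one>"
    using assms(1) path_in_join[OF assms(2) path_in_reverse[OF assms(3)]]
    unfolding trivial_on_def by blast
  then have "\<phi> p \<otimes> inv (\<phi> q) = \<one>"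
    using join[OF pq(1) path_in_reverse[OF pq(2)]] reverse[OF pq(2)] by simp
  then show ?thesis
    using inv_equality[of "\<phi> p" "inv (\<phi> q)"] closed[OF pq(1)] closed[OF pq(2)] by simp
qed

abbreviation seg :: "'a \<Rightarrow> 'a \<Rightarrow> 'q" where "seg a b \<equiv> \<phi> (linepath a b)"

lemma seg_closed: "closed_segment a b \<subseteq> S \<Longrightarrow> seg a b \<in> carrier Q"
  by (rule closed[OF path_in_linepath])

text \<open>The holonomy of the polygon with vertices \<open>a 0, \<dots>, a n\<close>.\<close>

primrec hol :: "(nat \<Rightarrow> 'a) \<Rightarrow> nat \<Rightarrow> 'q" where
  "hol a 0 = \<one>"
| "hol a (Suc j) = hol a j \<otimes> seg (a j) (a (Suc j))"

lemma hol_closed: "(\<And>j. j < n \<Longrightarrow> closed_segment (a j) (a (Suc j)) \<subseteq> S) \<Longrightarrow> hol a n \<in> carrier Q"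
  by (induction n) (auto simp: seg_closed)

lemma hol_const: "b \<in> S \<Longrightarrow> hol (\<lambda>_. b) n = \<one>"
  by (induction n) (auto simp: const)

lemma quadrilateral:
  assumes "trivial_on D" "convex D" "{x, y, z, w} \<subseteq> D"
    and "closed_segment x y \<subseteq> S" "closed_segment y z \<subseteq> S"
    and "closed_segment x w \<subseteq> S" "closed_segment w z \<subseteq> S"
  shows "seg x y \<otimes> seg y z = seg x w \<otimes> seg w z"
proof -
  have lp: "path_in (S \<inter> D) u v (linepath u v)"
    if "closed_segment u v \<subseteq> S" "u \<in> D" "v \<in> D" for u v
    using that closed_segment_subset[OF that(2,3) assms(2)] by (auto intro!: path_in_linepath)
  have D: "x \<in> D" "y \<in> D" "z \<in> D" "w \<in> D" using assms(3) by auto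
  have "\<phi> (linepath x y +++ linepath y z) = \<phi> (linepath x w +++ linepath w z)"
    using assms(4-) D
    by (intro trivial_on_unique[OF assms(1), of x z]) (rule path_in_join[OF lp lp]; assumption)+
  moreover have "\<phi> (linepath x y +++ linepath y z) = seg x y \<otimes> seg y z"
    by (rule join[OF path_in_linepath[OF assms(4)] path_in_linepath[OF assms(5)]])
  moreover have "\<phi> (linepath x w +++ linepath w z) = seg x w \<otimes> seg w z"
    by (rule join[OF path_in_linepath[OF assms(6)] path_in_linepath[OF assms(7)]])
  ultimately show ?thesis by simp
qed

text \<open>The two polygons bound a strip of quadrilaterals. If each of them lies in a convex set on which
  loops have trivial holonomy, the rungs of the strip telescope.\<close>

lemma hol_transfer:
  assumes "\<And>j. j < n \<Longrightarrow> closed_segment (a j) (a (Suc j)) \<subseteq> S"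
    and "\<And>j. j < n \<Longrightarrow> closed_segment (c j) (c (Suc j)) \<subseteq> S"
    and "\<And>j. j \<le> n \<Longrightarrow> closed_segment (a j) (c j) \<subseteq> S"
    and "\<And>j. j < n \<Longrightarrow> \<exists>D. trivial_on D \<and> convex D \<and> {a j, a (Suc j), c (Suc j), c j} \<subseteq> D"
  shows "hol a n \<otimes> seg (a n) (c n) = seg (a 0) (c 0) \<otimes> hol c n"
  using assms
proof (induction n)
  case 0
  then show ?case by (simp add: seg_closed)
next
  case (Suc n)
  have sc: "seg (a n) (c n) \<in> carrier Q" "seg (a n) (a (Suc n)) \<in> carrier Q"
    "seg (a (Suc n)) (c (Suc n)) \<in> carrier Q" "seg (c n) (c (Suc n)) \<in> carrier Q"
    "seg (a 0) (c 0) \<in> carrier Q"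
    using Suc.prems(1)[of n] Suc.prems(2)[of n] Suc.prems(3)[of n] Suc.prems(3)[of "Suc n"] Suc.prems(3)[of 0]
    by (auto simp: seg_closed)
  have hc: "hol a n \<in> carrier Q" "hol c n \<in> carrier Q"
    by (rule hol_closed, rule Suc.prems, rule less_SucI, assumption)+
  obtain D where "trivial_on D" "convex D" "{a n, a (Suc n), c (Suc n), c n} \<subseteq> D"
    using Suc.prems(4)[of n] by auto
  then have quad: "seg (a n) (a (Suc n)) \<otimes> seg (a (Suc n)) (c (Suc n)) = seg (a n) (c n) \<otimes> seg (c n) (c (Suc n))"
    using Suc.prems(1)[of n] Suc.prems(2)[of n] Suc.prems(3)[of n] Suc.prems(3)[of "Suc n"]
    by (intro quadrilateral[of D]) auto
  have "hol a (Suc n) \<otimes> seg (a (Suc n)) (c (Suc n))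
      = hol a n \<otimes> (seg (a n) (a (Suc n)) \<otimes> seg (a (Suc n)) (c (Suc n)))"
    using sc hc by (simp add: m_assoc)
  also have "\<dots> = (hol a n \<otimes> seg (a n) (c n)) \<otimes> seg (c n) (c (Suc n))"
    using sc hc by (simp add: quad m_assoc)
  also have "hol a n \<otimes> seg (a n) (c n) = seg (a 0) (c 0) \<otimes> hol c n"
    using Suc.prems by (intro Suc.IH) auto
  also have "\<dots> \<otimes> seg (c n) (c (Suc n)) = seg (a 0) (c 0) \<otimes> hol c (Suc n)"
    using sc hc by (simp add: m_assoc)
  finally show ?case .
qed

corollary hol_transfer_loop:
  assumes "\<And>j. j < n \<Longrightarrow> closed_segment (a j) (a (Suc j)) \<subseteq> S"
    and "\<And>j. j < n \<Longrightarrow> closed_segment (c j) (c (Suc j)) \<subseteq> S"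
    and "\<And>j. j \<le> n \<Longrightarrow> closed_segment (a j) (c j) \<subseteq> S"
    and "\<And>j. j < n \<Longrightarrow> \<exists>D. trivial_on D \<and> convex D \<and> {a j, a (Suc j), c (Suc j), c j} \<subseteq> D"
    and "a 0 = b" "c 0 = b" "a n = b" "c n = b"
  shows "hol a n = hol c n"
proof -
  have "b \<in> S" using assms(3)[of 0] assms(5,6) by auto
  then show ?thesis
    using hol_transfer[of n a c] assms const[of b] hol_closed[of n a] hol_closed[of n c] by simp
qed

text \<open>Each edge of a sufficiently fine inscribed polygon is homotopic to the arc it replaces, inside a
  ball that stays in \<open>S\<close>. The mesh is also below \<open>\<eta>\<close>, which allows comparison with further polygons.\<close>

lemma fine_polygon:
  assumes p: "path_in A b b' p" and "\<eta> > 0" and d: "\<And>x. x \<in> A \<Longrightarrow> ball x \<eta> \<subseteq> S"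
  obtains n c where "n > 0" "c 0 = b" "c n = b'" "\<And>j. j \<le> n \<Longrightarrow> c j \<in> A"
    "\<And>j. j < n \<Longrightarrow> dist (c j) (c (Suc j)) < \<eta>"
    "\<And>j. j < n \<Longrightarrow> closed_segment (c j) (c (Suc j)) \<subseteq> S" "\<phi> p = hol c n"
proof -
  have pA: "p t \<in> A" if "t \<in> {0..1}" for t
    using p that by (auto simp: path_in_def path_image_def)
  have AS: "A \<subseteq> S" using d \<open>\<eta> > 0\<close> by force
  have path: "path p" "pathstart p = b" "pathfinish p = b'" using p by (auto simp: path_in_def)
  have pS: "path_in S b b' p" using path_in_mono[OF p AS] .
  have "uniformly_continuous_on {0..1} p"
    using path(1) by (simp add: path_def compact_uniformly_continuous)
  then obtain \<delta> where "\<delta> > 0" and \<delta>: "\<And>s t. s \<in> {0..1} \<Longrightarrow> t \<in> {0..1} \<Longrightarrow> dist s t < \<delta> \<Longrightarrow> dist (p s) (p t) < \<eta>"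
    using \<open>\<eta> > 0\<close> unfolding uniformly_continuous_on_def by metis
  obtain n where n: "n > 0" "1 / real n < \<delta>"
    using real_arch_inverse[of \<delta>] \<open>\<delta> > 0\<close> by (auto simp: inverse_eq_divide)
  let ?t = "\<lambda>j. real j / real n"
  define c where "c = (\<lambda>j. p (?t j))"
  have t01: "?t j \<in> {0..1}" if "j \<le> n" for j using that n by auto
  have near: "dist (p s) (p (?t j)) < \<eta>" if "j < n" "s \<in> {?t j..?t (Suc j)}" for s j
  proof (rule \<delta>)
    have "?t (Suc j) \<le> 1" "0 \<le> ?t j" using that n by auto
    then have "0 \<le> s" "s \<le> 1" using that(2) unfolding atLeastAtMost_iff by linarith+
    then show "s \<in> {0..1}" by simp
    show "?t j \<in> {0..1}" using t01 that by auto
    have "?t (Suc j) = ?t j + 1 / real n" by (simp add: add_divide_distrib)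
    then show "dist s (?t j) < \<delta>" using that(2) n(2) by (auto simp: dist_real_def)
  qed
  have step: "?t j \<le> ?t (Suc j)" for j by (intro divide_right_mono) auto
  have seg_S: "closed_segment (c j) (c (Suc j)) \<subseteq> ball (c j) \<eta>" if "j < n" for j
    using near[OF that, of "?t (Suc j)"] step \<open>\<eta> > 0\<close>
    by (intro closed_segment_subset) (auto simp: c_def dist_commute)
  have ball_S: "ball (c j) \<eta> \<subseteq> S" if "j \<le> n" for j
    unfolding c_def by (rule d[OF pA[OF t01[OF that]]])
  have sub: "\<phi> (subpath 0 (?t j) p) = hol c j" if "j \<le> n" for j
    using that
  proof (induction j)
    case 0
    have "subpath 0 0 p = linepath b b"
      using path(2) by (simp add: fun_eq_iff subpath_def linepath_def pathstart_def algebra_simps)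
    then have "\<phi> (subpath 0 0 p) = \<one>" using const[of b] path_in_endpoints[OF pS] by (simp only:)
    then show ?case by (simp only: hol.simps of_nat_0 div_0)
  next
    case (Suc j)
    then have j: "j < n" by simp
    have q: "path_in S (p u) (p v) (subpath u v p)" if "u \<in> {0..1}" "v \<in> {0..1}" for u v
      using that path(1) pS path_image_subpath_subset[of u v p] unfolding path_in_def
      by (auto simp: pathstart_subpath pathfinish_subpath)
    have "subpath (?t j) (?t (Suc j)) p \<in> {q. path_in (ball (c j) \<eta>) (c j) (c (Suc j)) q}"
      using near[OF j] path(1) t01[of j] t01[of "Suc j"] j step[of j]
      by (auto simp: path_in_def c_def path_image_subpath dist_commute pathstart_subpath
          pathfinish_subpath path_subpath)
    then have "homotopic_paths (ball (c j) \<eta>) (subpath (?t j) (?t (Suc j)) p) (linepath (c j) (c (Suc j)))"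
      using seg_S[OF j] by (intro homotopic_paths_convex) (auto intro!: path_in_linepath)
    then have *: "\<phi> (subpath (?t j) (?t (Suc j)) p) = seg (c j) (c (Suc j))"
      using ball_S[of j] j by (intro homotopic) (auto intro: homotopic_paths_subset)
    have "\<phi> (subpath 0 (?t (Suc j)) p) = \<phi> (subpath 0 (?t j) p +++ subpath (?t j) (?t (Suc j)) p)"
      using path(1) pS t01[of j] t01[of "Suc j"] Suc.prems
      by (intro homotopic homotopic_paths_sym[OF homotopic_join_subpaths]) (auto simp: path_in_def)
    also have "\<dots> = \<phi> (subpath 0 (?t j) p) \<otimes> \<phi> (subpath (?t j) (?t (Suc j)) p)"
      using t01[of j] t01[of "Suc j"] Suc.prems by (intro join[OF q q]) auto
    finally show ?case using Suc * by simp
  qed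
  show ?thesis
  proof (rule that)
    show "n > 0" by fact
    show "c 0 = b" "c n = b'" using path n by (auto simp: c_def pathstart_def pathfinish_def)
    show "c j \<in> A" if "j \<le> n" for j unfolding c_def by (rule pA[OF t01[OF that]])
    show "dist (c j) (c (Suc j)) < \<eta>" if "j < n" for j
      using near[OF that, of "?t (Suc j)"] step[of j] by (auto simp: c_def dist_commute)
    show "closed_segment (c j) (c (Suc j)) \<subseteq> S" if "j < n" for j
      using seg_S[OF that] ball_S[of j] that by auto
    show "\<phi> p = hol c n" using sub[of n] n by (simp add: subpath_trivial)
  qed
qed

text \<open>Take a finite net of the compact set that is finer than its distance from the complement of
  \<open>S\<close>. Every loop has the holonomy of a polygon with vertices in the net, and there are only
  finitely many edges between vertices of the net.\<close>

theorem finitely_generated_on_compact: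
  assumes "open S" "compact A" "A \<subseteq> S"
  shows "\<exists>X. finite X \<and> X \<subseteq> carrier Q \<and> (\<forall>p. path_in A b b p \<longrightarrow> \<phi> p \<in> generate Q X)"
proof (cases "b \<in> A")
  case False
  then have "\<not> path_in A b b p" for p using path_in_endpoints by blast
  then show ?thesis by (intro exI[of _ "{}"]) auto
next
  case True
  obtain d where "d > 0" and d: "\<And>x. x \<in> A \<Longrightarrow> ball x d \<subseteq> S"
  proof -
    have "A \<inter> - S = {}" "closed (- S)" using assms by auto
    then obtain d where "d > 0" "\<And>x y. x \<in> A \<Longrightarrow> y \<in> - S \<Longrightarrow> d \<le> dist x y"
      using separate_compact_closed[OF assms(2)] by metis
    then have "ball x d \<subseteq> S" if "x \<in> A" for x
      using that by (force simp: subset_iff)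
    with \<open>d > 0\<close> that show ?thesis by blast
  qed
  \<comment> \<open>The two steps from a vertex to its successor and on to the net point of the successor are shorter than \<open>d / 2\<close>.\<close>
  let ?\<eta> = "d / 4"
  obtain N where N: "finite N" "N \<subseteq> A" "A \<subseteq> (\<Union>x\<in>N. ball x ?\<eta>)"
    using compactE_image[OF assms(2), of A "\<lambda>x. ball x ?\<eta>"] \<open>d > 0\<close>
    by (metis centre_in_ball UN_I open_ball subsetI zero_less_divide_iff zero_less_numeral)
  let ?N = "insert b N"
  let ?X = "(\<lambda>(x, y). seg x y) ` {(x, y) \<in> ?N \<times> ?N. closed_segment x y \<subseteq> S}"
  have X: "?X \<subseteq> carrier Q" by (auto simp: seg_closed)
  have "\<phi> p \<in> generate Q ?X" if p: "path_in A b b p" for p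
  proof -
    obtain n c where c: "n > 0" "c 0 = b" "c n = b" "\<And>j. j \<le> n \<Longrightarrow> c j \<in> A"
      "\<And>j. j < n \<Longrightarrow> dist (c j) (c (Suc j)) < ?\<eta>"
      "\<And>j. j < n \<Longrightarrow> closed_segment (c j) (c (Suc j)) \<subseteq> S" "\<phi> p = hol c n"
      by (rule fine_polygon[OF p, of ?\<eta>]) (use \<open>d > 0\<close> d subset_ball[of ?\<eta> d] in \<open>auto simp: subset_iff\<close>)
    define a where "a = (\<lambda>j. if j = 0 \<or> j = n then b else SOME x. x \<in> N \<and> c j \<in> ball x ?\<eta>)"
    have a: "a j \<in> ?N" "dist (a j) (c j) < ?\<eta>" if "j \<le> n" for j
    proof -
      have "\<exists>x. x \<in> N \<and> c j \<in> ball x ?\<eta>" using N(3) c(4)[OF that] by blast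
      from someI_ex[OF this] show "a j \<in> ?N" "dist (a j) (c j) < ?\<eta>"
        using c(2,3) \<open>d > 0\<close> by (auto simp: a_def)
    qed
    have quad: "{c j, c (Suc j), a (Suc j), a j} \<subseteq> ball (c j) d" if "j < n" for j
    proof -
      have "dist (c j) (a (Suc j)) < ?\<eta> + ?\<eta>"
        using dist_triangle[of "c j" "a (Suc j)" "c (Suc j)"] c(5)[OF that] a(2)[of "Suc j"] that
        by (simp add: dist_commute)
      then show ?thesis using c(5)[OF that] a(2)[of j] that \<open>d > 0\<close> by (auto simp: dist_commute)
    qed
    have bS: "ball (c j) d \<subseteq> S" if "j \<le> n" for j using d c(4)[OF that] by blast
    have seg_a: "closed_segment (a j) (a (Suc j)) \<subseteq> S" if "j < n" for j
      using quad[OF that] bS[of j] that closed_segment_subset[of "a j" "ball (c j) d" "a (Suc j)"] by auto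
    have "hol c n = hol a n"
    proof (rule hol_transfer_loop[of n c a b])
      show "closed_segment (c j) (a j) \<subseteq> S" if "j \<le> n" for j
        using a(2)[OF that] bS[OF that] \<open>d > 0\<close> closed_segment_subset[of "c j" "ball (c j) d" "a j"]
        by (auto simp: dist_commute)
      show "\<exists>D. trivial_on D \<and> convex D \<and> {c j, c (Suc j), a (Suc j), a j} \<subseteq> D" if "j < n" for j
        using quad[OF that] bS[of j] that by (intro exI[of _ "ball (c j) d"]) (auto intro!: trivial_on_convex)
    qed (use c seg_a in \<open>auto simp: a_def\<close>)
    moreover have "hol a j \<in> generate Q ?X" if "j \<le> n" for j
      using that
    proof (induction j)
      case 0 then show ?case by (simp add: generate.one)
    next
      case (Suc j)
      then have "seg (a j) (a (Suc j)) \<in> ?X"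
        using a(1)[of j] a(1)[of "Suc j"] seg_a[of j] by force
      with Suc show ?case unfolding hol.simps by (intro generate.eng[OF _ generate.incl]) auto
    qed
    ultimately show ?thesis using c(7) by simp
  qed
  moreover have "finite ?X"
    by (rule finite_imageI, rule finite_subset[of _ "?N \<times> ?N"]) (use N(1) in auto)
  ultimately show ?thesis using X by blast
qed

text \<open>Vertices are chosen one after the other, each in general position to \<open>F\<close> and to its predecessors.\<close>

lemma generic_chain:
  fixes n :: nat
  assumes gen: "\<And>F y \<delta>. finite F \<Longrightarrow> F \<subseteq> S \<Longrightarrow> \<delta> > 0 \<Longrightarrow>
      \<exists>a\<in>S. dist a y < \<delta> \<and> (\<forall>f\<in>F. closed_segment a f \<subseteq> S)"
    and "finite F" "F \<subseteq> S" "\<delta> > (0::real)"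
  shows "\<exists>c. \<forall>j<n. c j \<in> S \<and> dist (c j) (P j) < \<delta> \<and> (\<forall>f\<in>F. closed_segment (c j) f \<subseteq> S)
      \<and> (\<forall>i<j. closed_segment (c i) (c j) \<subseteq> S)"
proof (induction n)
  case (Suc n)
  then obtain c where c: "\<And>j. j < n \<Longrightarrow> c j \<in> S \<and> dist (c j) (P j) < \<delta> \<and> (\<forall>f\<in>F. closed_segment (c j) f \<subseteq> S)
      \<and> (\<forall>i<j. closed_segment (c i) (c j) \<subseteq> S)" by blast
  obtain x where x: "x \<in> S" "dist x (P n) < \<delta>" "\<And>f. f \<in> F \<union> c ` {..<n} \<Longrightarrow> closed_segment x f \<subseteq> S"
  proof -
    have "finite (F \<union> c ` {..<n})" "F \<union> c ` {..<n} \<subseteq> S" using assms(2,3) c by auto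
    from gen[OF this assms(4), of "P n"] that show ?thesis by blast
  qed
  have "closed_segment (c i) x \<subseteq> S" if "i < n" for i
    using x(3)[of "c i"] that by (simp add: closed_segment_commute)
  with c x show ?case
    by (intro exI[of _ "c(n := x)"]) (simp add: less_Suc_eq)
qed simp

text \<open>The straight contraction \<open>(1 - t) p + t b\<close> of the loop to its base point may leave \<open>S\<close>. Cut it into
  finitely many polygons with close vertices and move the vertices other than \<open>b\<close> into general position.
  Then the edges lie in \<open>S\<close>, and consecutive polygons differ by quadrilaterals in balls of radius
  \<open>\<epsilon>\<close>, whose holonomy is trivial. The last polygon lies in a ball around \<open>b\<close>
  inside \<open>S\<close>.\<close>

theorem trivial_if_locally_trivial:
  assumes "open S"
    and gen: "\<And>F y \<delta>. finite F \<Longrightarrow> F \<subseteq> S \<Longrightarrow> \<delta> > 0 \<Longrightarrow>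
      \<exists>a\<in>S. dist a y < \<delta> \<and> (\<forall>f\<in>F. closed_segment a f \<subseteq> S)"
    and "\<epsilon> > 0" and small: "\<And>y. trivial_on (ball y \<epsilon>)"
    and p: "path_in S b b p"
  shows "\<phi> p = \<one>"
proof -
  have bS: "b \<in> S" using path_in_endpoints[OF p] by simp
  obtain d where "d > 0" and d: "\<And>x. x \<in> insert b (path_image p) \<Longrightarrow> ball x d \<subseteq> S"
  proof -
    have "insert b (path_image p) \<inter> - S = {}" "closed (- S)" "compact (insert b (path_image p))"
      using assms(1) p bS by (auto simp: path_in_def intro: compact_insert compact_path_image)
    then obtain d where "d > 0" "\<And>x y. x \<in> insert b (path_image p) \<Longrightarrow> y \<in> - S \<Longrightarrow> d \<le> dist x y"
      using separate_compact_closed by metis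
    then have "ball x d \<subseteq> S" if "x \<in> insert b (path_image p)" for x
      using that by (force simp: subset_iff)
    with \<open>d > 0\<close> that show ?thesis by blast
  qed
  \<comment> \<open>Two steps of length \<open>\<eta>\<close> between unperturbed vertices and one perturbation stay below \<open>4 \<eta>\<close>.\<close>
  define \<eta> where "\<eta> = min d (\<epsilon> / 4)"
  have \<eta>: "\<eta> > 0" "\<eta> \<le> d" "4 * \<eta> \<le> \<epsilon>" using \<open>d > 0\<close> \<open>\<epsilon> > 0\<close> by (auto simp: \<eta>_def)
  have "path_in (path_image p) b b p" using p by (auto simp: path_in_def)
  moreover have "ball x \<eta> \<subseteq> S" if "x \<in> path_image p" for x
    using d[of x] that \<eta>(2) subset_ball[of \<eta> d x] by auto
  ultimately obtain n q where q: "n > 0" "q 0 = b" "q n = b" "\<And>j. j \<le> n \<Longrightarrow> q j \<in> path_image p"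
      "\<And>j. j < n \<Longrightarrow> dist (q j) (q (Suc j)) < \<eta>"
      "\<And>j. j < n \<Longrightarrow> closed_segment (q j) (q (Suc j)) \<subseteq> S" "\<phi> p = hol q n"
    using fine_polygon \<eta>(1) by metis
  have qS: "q j \<in> S" if "j \<le> n" for j using q(4)[OF that] d \<open>d > 0\<close> by force
  obtain k where k: "k > 0" "\<And>j. j \<le> n \<Longrightarrow> dist (q j) b < real k * \<eta>"
  proof -
    have "bdd_above ((\<lambda>j. dist (q j) b) ` {..n})" by simp
    then obtain M where M: "\<And>j. j \<le> n \<Longrightarrow> dist (q j) b \<le> M" by (auto simp: bdd_above_def)
    obtain k where k: "M < real k * \<eta>" using reals_Archimedean3[OF \<eta>(1)] by blast
    have "M \<ge> 0" using M[of 0] zero_le_dist order_trans by blast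
    then have "k > 0" using k \<eta>(1) by (cases k) auto
    with that M k show ?thesis by (meson order.strict_trans1)
  qed
  define P where "P = (\<lambda>i j. q j + (real i / real k) *\<^sub>R (b - q j))"
  have P_row: "dist (P i j) (P i (Suc j)) < \<eta>" if "j < n" "i \<le> k" for i j
  proof -
    have "P i j - P i (Suc j) = (1 - real i / real k) *\<^sub>R (q j - q (Suc j))"
      by (simp add: P_def algebra_simps)
    then have "dist (P i j) (P i (Suc j)) = \<bar>1 - real i / real k\<bar> * dist (q j) (q (Suc j))"
      by (simp add: dist_norm)
    also have "\<dots> \<le> 1 * dist (q j) (q (Suc j))"
      using that k(1) by (intro mult_right_mono) auto
    also have "\<dots> < \<eta>" using q(5)[OF that(1)] by simp
    finally show ?thesis .
  qed
  have P_col: "dist (P i j) (P (Suc i) j) < \<eta>" if "j \<le> n" for i j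
  proof -
    have "P i j - P (Suc i) j = - (1 / real k) *\<^sub>R (b - q j)"
      by (simp add: P_def algebra_simps add_divide_distrib)
    then have "dist (P i j) (P (Suc i) j) = dist (q j) b / real k"
      by (simp add: dist_norm norm_minus_commute)
    also have "\<dots> < \<eta>" using k(2)[OF that] k(1) by (simp add: field_simps)
    finally show ?thesis .
  qed
  have P_end: "P i j = b" if "j = 0 \<or> j = n" for i j
    using that q(2,3) by (auto simp: P_def)
  have row: "\<exists>a. a 0 = b \<and> a n = b \<and> (\<forall>j\<le>n. a j \<in> S \<and> dist (a j) (P i j) < \<eta>)
      \<and> (\<forall>j<n. closed_segment (a j) (a (Suc j)) \<subseteq> S) \<and> hol a n = \<phi> p" if "i \<le> k" for i
    using that
  proof (induction i)
    case 0
    show ?case using q qS \<eta>(1) by (intro exI[of _ q]) (auto simp: P_def)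
  next
    case (Suc i)
    then obtain a where a: "a 0 = b" "a n = b" "\<And>j. j \<le> n \<Longrightarrow> a j \<in> S" "\<And>j. j \<le> n \<Longrightarrow> dist (a j) (P i j) < \<eta>"
      "\<And>j. j < n \<Longrightarrow> closed_segment (a j) (a (Suc j)) \<subseteq> S" "hol a n = \<phi> p" by auto
    obtain c' where c': "\<And>j. j < n \<Longrightarrow> c' j \<in> S \<and> dist (c' j) (P (Suc i) j) < \<eta>
      \<and> (\<forall>f\<in>a ` {..n}. closed_segment (c' j) f \<subseteq> S) \<and> (\<forall>i<j. closed_segment (c' i) (c' j) \<subseteq> S)"
  proof -
      have "finite (a ` {..n})" "a ` {..n} \<subseteq> S" using a(3) by auto
      from generic_chain[OF gen this \<eta>(1), of n "P (Suc i)"] that show ?thesis by blast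
    qed
    define c where "c = (\<lambda>j. if j = 0 \<or> j = n then b else c' j)"
    have c_ends: "c 0 = b" "c n = b" by (auto simp: c_def)
    have c_S: "c j \<in> S" "dist (c j) (P (Suc i) j) < \<eta>" if "j \<le> n" for j
      using c'[of j] that bS P_end[of j "Suc i"] \<eta>(1) by (auto simp: c_def)
    have c_a: "closed_segment (c j) (a i) \<subseteq> S" if "c j \<noteq> b" "j \<le> n" "i \<le> n" for i j
      using c'[of j] that by (auto simp: c_def split: if_splits)
    have c_b: "closed_segment (c j) b \<subseteq> S" if "j \<le> n" for j
      using c_a[of j 0] that a(1) bS by (cases "c j = b") auto
    have c_c: "closed_segment (c j) (c (Suc j)) \<subseteq> S" if "j < n" for j
    proof (cases "j = 0 \<or> Suc j = n")
      case True
      then show ?thesis using c_b[of j] c_b[of "Suc j"] c_ends that by (auto simp: closed_segment_commute)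
    next
      case False
      then show ?thesis using c'[of "Suc j"] that by (auto simp: c_def)
    qed
    have a_c: "closed_segment (a j) (c j) \<subseteq> S" if "j \<le> n" for j
    proof (cases "j = 0 \<or> j = n")
      case True then show ?thesis using a(1,2) c_ends bS by auto
    next
      case False then show ?thesis using c'[of j] that by (auto simp: c_def closed_segment_commute)
    qed
    have "hol a n = hol c n"
    proof (rule hol_transfer_loop[of n a c b, OF a(5) c_c a_c])
      fix j assume j: "j < n"
      have "dist (P i j) (a (Suc j)) < 4 * \<eta>"
        using dist_triangle[of "P i j" "a (Suc j)" "P i (Suc j)"] P_row[OF j, of i] a(4)[of "Suc j"] j Suc.prems
          \<eta>(1) by (simp add: dist_commute)
      moreover have "dist (P i j) (c j) < 4 * \<eta>"
        using dist_triangle[of "P i j" "c j" "P (Suc i) j"] P_col[of j i] c_S(2)[of j] j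
          \<eta>(1) by (simp add: dist_commute)
      moreover have "dist (P i j) (c (Suc j)) < 4 * \<eta>"
        using dist_triangle[of "P i j" "P (Suc i) (Suc j)" "P i (Suc j)"]
          dist_triangle[of "P i j" "c (Suc j)" "P (Suc i) (Suc j)"]
          P_row[OF j, of i] P_col[of "Suc j" i] c_S(2)[of "Suc j"] j Suc.prems
          \<eta>(1) by (simp add: dist_commute)
      moreover have "dist (P i j) (a j) < 4 * \<eta>" using a(4)[of j] j \<eta>(1) by (simp add: dist_commute)
      ultimately show "\<exists>D. trivial_on D \<and> convex D \<and> {a j, a (Suc j), c (Suc j), c j} \<subseteq> D"
        using small[of "P i j"] \<eta>(3) by (intro exI[of _ "ball (P i j) \<epsilon>"]) auto
    qed (use a(1,2) c_ends in auto)
    then show ?case using a(6) c_ends c_S c_c by (intro exI[of _ c]) auto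
  qed
  obtain a where a: "a 0 = b" "a n = b" "\<And>j. j \<le> n \<Longrightarrow> dist (a j) (P k j) < \<eta>"
      "\<And>j. j < n \<Longrightarrow> closed_segment (a j) (a (Suc j)) \<subseteq> S" "hol a n = \<phi> p"
    using row[of k] by auto
  have ball_b: "ball b \<eta> \<subseteq> S" using d[of b] \<eta>(2) subset_ball[of \<eta> d b] by auto
  have a_ball: "a j \<in> ball b \<eta>" if "j \<le> n" for j
    using a(3)[OF that] k(1) by (simp add: P_def dist_commute)
  have "hol a n = hol (\<lambda>_. b) n"
  proof (rule hol_transfer_loop[of n a _ b, OF a(4)])
    show "closed_segment (a j) b \<subseteq> S" if "j \<le> n" for j
      using a_ball[OF that] ball_b \<eta>(1) closed_segment_subset[of "a j" "ball b \<eta>" b] by auto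
    show "\<exists>D. trivial_on D \<and> convex D \<and> {a j, a (Suc j), b, b} \<subseteq> D" if "j < n" for j
      using a_ball[of j] a_ball[of "Suc j"] that ball_b \<eta>(1)
      by (intro exI[of _ "ball b \<eta>"]) (auto intro!: trivial_on_convex)
  qed (use a bS in auto)
  then show ?thesis using a(5) hol_const[OF bS] by simp
qed

end

text \<open>Paths in \<open>C\<close> become loops by prefixing and suffixing chosen paths \<open>w\<close> from the base point; the
  retraction then moves these loops into \<open>E\<close>. The chosen path at the base point is constant, which
  makes the holonomy of a loop in \<open>E\<close> its own class.\<close>

lemma retraction_holonomy:
  fixes E C :: "'a::euclidean_space set"
  assumes EC: "E \<subseteq> C" and contr: "continuous_on C r" and r: "r \<in> C \<rightarrow> E" and r_id: "\<And>x. x \<in> E \<Longrightarrow> r x = x"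
    and b: "b \<in> E" and pc: "path_connected C"
  obtains \<phi> where "holonomy (fundamental_group E b) C \<phi>"
    and "\<And>p. path_in E b b p \<Longrightarrow> \<phi> p = loop_class E p"
proof -
  have bC: "b \<in> C" using b EC by blast
  have "\<exists>w. path_in C b a w" if "a \<in> C" for a
    using pc that bC unfolding path_connected_def path_in_def by blast
  then have "\<forall>a\<in>C. \<exists>w. path_in C b a w" by blast
  then obtain w' where w': "\<And>a. a \<in> C \<Longrightarrow> path_in C b a (w' a)" by metis
  define w where "w = (\<lambda>a. if a = b then linepath b b else w' a)"
  have w: "path_in C b a (w a)" if "a \<in> C" for a
    using w'[OF that] path_in_const[OF bC] by (simp add: w_def)
  define based where "based = (\<lambda>p. w (pathstart p) +++ (p +++ reversepath (w (pathfinish p))))"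
  have based: "path_in C b b (based p)" if p: "path_in C a c p" for a c p
  proof -
    have "pathstart p = a" "pathfinish p = c" "a \<in> C" "c \<in> C"
      using p path_in_endpoints[OF p] by (auto simp: path_in_def)
    then show ?thesis
      unfolding based_def by (simp add: path_in_join[OF w path_in_join[OF p path_in_reverse[OF w]]])
  qed
  define \<phi> where "\<phi> = (\<lambda>p. loop_class E (r \<circ> based p))"
  have push: "path_in E b b (r \<circ> q)" if "path_in C b b q" for q
    using path_in_image[OF that contr r] r_id[OF b] by simp
  have push_eq: "loop_class E (r \<circ> q) = loop_class E (r \<circ> q')" if "homotopic_paths C q q'" for q q'
    by (rule loop_class_eq[OF homotopic_paths_continuous_image[OF that contr r]])
  show ?thesis
  proof (rule that)
    interpret group "fundamental_group E b" by (rule group_fundamental_group[OF b])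
    show "holonomy (fundamental_group E b) C \<phi>"
    proof
      fix a c p assume p: "path_in C a c p"
      show "\<phi> p \<in> carrier (fundamental_group E b)"
        unfolding \<phi>_def by (rule loop_class_in_group[OF push[OF based[OF p]]])
      fix d q assume q: "path_in C c d q"
      have acd: "a \<in> C" "c \<in> C" "d \<in> C" using path_in_endpoints[OF p] path_in_endpoints[OF q] by auto
      let ?wa = "w a" and ?wc = "w c" and ?wd = "w d"
      note W = w[OF acd(1)] w[OF acd(2)] w[OF acd(3)]
      note R = path_in_reverse[OF W(2)] path_in_reverse[OF W(3)]
      let ?X = "q +++ reversepath ?wd"
      have X: "path_in C c b ?X" by (rule path_in_join[OF q R(2)])
      have eqs: "based p = ?wa +++ (p +++ reversepath ?wc)" "based q = ?wc +++ ?X"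
        "based (p +++ q) = ?wa +++ ((p +++ q) +++ reversepath ?wd)"
        using p q by (auto simp: based_def path_in_def)
      have "homotopic_paths C (reversepath ?wc +++ (?wc +++ ?X)) ((reversepath ?wc +++ ?wc) +++ ?X)"
        by (rule homotopic_paths_sym[OF homotopic_paths_assoc'[OF R(1) W(2) X]])
      also have "homotopic_paths C \<dots> (linepath c c +++ ?X)"
        using W(2) homotopic_paths_linv[of ?wc C]
        by (intro homotopic_paths_join'[OF _ homotopic_paths_refl'[OF X] path_in_join[OF R(1) W(2)] X])
          (auto simp: path_in_def)
      also have "homotopic_paths C \<dots> ?X"
        using X by (intro homotopic_paths_lid') (auto simp: path_in_def)
      finally have cancel: "homotopic_paths C (reversepath ?wc +++ (?wc +++ ?X)) ?X" .
      have "homotopic_paths C ((p +++ reversepath ?wc) +++ (?wc +++ ?X)) (p +++ (reversepath ?wc +++ (?wc +++ ?X)))"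
        by (rule homotopic_paths_assoc'[OF p R(1) path_in_join[OF W(2) X]])
      also have "homotopic_paths C \<dots> (p +++ ?X)"
        by (rule homotopic_paths_join'[OF homotopic_paths_refl'[OF p] cancel p
            path_in_join[OF R(1) path_in_join[OF W(2) X]]])
      also have "homotopic_paths C \<dots> ((p +++ q) +++ reversepath ?wd)"
        by (rule homotopic_paths_sym[OF homotopic_paths_assoc'[OF p q R(2)]])
      finally have mid: "homotopic_paths C ((p +++ reversepath ?wc) +++ (?wc +++ ?X))
          ((p +++ q) +++ reversepath ?wd)" .
      have pc: "path_in C a b (p +++ reversepath ?wc)" and cX: "path_in C b b (?wc +++ ?X)"
        by (rule path_in_join[OF p R(1)], rule path_in_join[OF W(2) X])
      have "homotopic_paths C (based p +++ based q) (?wa +++ ((p +++ reversepath ?wc) +++ (?wc +++ ?X)))"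
        unfolding eqs by (rule homotopic_paths_assoc'[OF W(1) pc cX])
      also have "homotopic_paths C \<dots> (based (p +++ q))"
        unfolding eqs
        by (rule homotopic_paths_join'[OF homotopic_paths_refl'[OF W(1)] mid W(1) path_in_join[OF pc cX]])
      finally have "loop_class E (r \<circ> (based p +++ based q)) = \<phi> (p +++ q)"
        unfolding \<phi>_def by (rule push_eq)
      then show "\<phi> (p +++ q) = \<phi> p \<otimes>\<^bsub>fundamental_group E b\<^esub> \<phi> q"
        unfolding \<phi>_def loop_class_mult[OF push[OF based[OF p]] push[OF based[OF q]]]
        by (simp add: path_compose_join)
    next
      fix p q assume h: "homotopic_paths C p q"
      let ?a = "pathstart p" and ?c = "pathfinish p"
      have p: "path_in C ?a ?c p"
        using homotopic_paths_imp_path[OF h] homotopic_paths_imp_subset[OF h] by (simp add: path_in_def)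
      have ends: "pathstart q = ?a" "pathfinish q = ?c"
        using homotopic_paths_imp_pathstart[OF h] homotopic_paths_imp_pathfinish[OF h] by simp_all
      note W = w[of ?a] path_in_reverse[OF w[of ?c]]
      have C: "?a \<in> C" "?c \<in> C" using path_in_endpoints[OF p] by auto
      have "homotopic_paths C (based p) (based q)"
        unfolding based_def ends
        by (rule homotopic_paths_join'[OF homotopic_paths_refl'[OF W(1)[OF C(1)]]
              homotopic_paths_join'[OF h homotopic_paths_refl'[OF W(2)[OF C(2)]] p W(2)[OF C(2)]]
              W(1)[OF C(1)] path_in_join[OF p W(2)[OF C(2)]]])
      then show "\<phi> p = \<phi> q" unfolding \<phi>_def by (rule push_eq)
    qed
  next
    fix p assume p: "path_in E b b p"
    have pC: "path_in C b b p" using path_in_mono[OF p EC] .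
    have "based p = linepath b b +++ (p +++ linepath b b)"
      using p by (simp add: based_def w_def path_in_def)
    then have "homotopic_paths C (based p) (p +++ linepath b b)"
      using path_in_join[OF pC path_in_const[OF bC]]
      by (auto simp: path_in_def intro: homotopic_paths_lid')
    also have "homotopic_paths C \<dots> p"
      using pC by (intro homotopic_paths_rid') (auto simp: path_in_def)
    finally have "\<phi> p = loop_class E (r \<circ> p)"
      unfolding \<phi>_def by (rule push_eq)
    also have "\<dots> = loop_class E p"
    proof (intro loop_class_eq[symmetric] homotopic_paths_eq)
      fix t :: real assume "t \<in> {0..1}"
      then have "p t \<in> E" using p by (auto simp: path_in_def path_image_def)
      then show "p t = (r \<circ> p) t" using r_id by simp
    qed (use p in \<open>auto simp: path_in_def\<close>)
    finally show "\<phi> p = loop_class E p" .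
  qed
qed

lemma (in holonomy) quotient_holonomy:
  assumes "N \<lhd> Q"
  shows "holonomy (Q Mod N) S (\<lambda>p. N #> \<phi> p)"
proof -
  interpret N: normal N Q by fact
  interpret M: group "Q Mod N" by (rule N.factorgroup_is_group)
  show ?thesis
  proof
    fix a b p assume p: "path_in S a b p"
    show "N #> \<phi> p \<in> carrier (Q Mod N)"
      using closed[OF p] by (auto simp: FactGroup_def RCOSETS_def)
    fix c q assume q: "path_in S b c q"
    show "N #> \<phi> (p +++ q) = (N #> \<phi> p) \<otimes>\<^bsub>Q Mod N\<^esub> (N #> \<phi> q)"
      using closed[OF p] closed[OF q] by (simp add: FactGroup_def N.rcos_sum join[OF p q])
  qed (simp add: homotopic)
qed

section \<open>Groups generated by conjugates\<close>

context group
begin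

text \<open>A word in the generators uses only finitely many of them.\<close>

lemma generate_finite_support:
  assumes "x \<in> generate G (f ` A)"
  shows "\<exists>B. finite B \<and> B \<subseteq> A \<and> x \<in> generate G (f ` B)"
  using assms
proof (induction rule: generate.induct)
  case one show ?case by (intro exI[of _ "{}"]) (auto intro: generate.one)
next
  case (incl h)
  then obtain a where "a \<in> A" "h = f a" by auto
  then show ?case by (intro exI[of _ "{a}"]) (auto intro: generate.incl)
next
  case (inv h)
  then obtain a where "a \<in> A" "h = f a" by auto
  then show ?case by (intro exI[of _ "{a}"]) (auto intro: generate.inv)
next
  case (eng h1 h2)
  then obtain B1 B2 where B: "finite B1" "B1 \<subseteq> A" "h1 \<in> generate G (f ` B1)"
    "finite B2" "B2 \<subseteq> A" "h2 \<in> generate G (f ` B2)" by blast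
  have "generate G (f ` B1) \<subseteq> generate G (f ` (B1 \<union> B2))" "generate G (f ` B2) \<subseteq> generate G (f ` (B1 \<union> B2))"
    by (intro mono_generate; auto)+
  with B show ?case by (intro exI[of _ "B1 \<union> B2"]) (auto intro: generate.eng)
qed

lemma normal_closure:
  assumes "m \<in> carrier G"
  shows "generate G ((\<lambda>g. g \<otimes> m \<otimes> inv g) ` carrier G) \<lhd> G"
proof (rule normal_generateI)
  show "(\<lambda>g. g \<otimes> m \<otimes> inv g) ` carrier G \<subseteq> carrier G" using assms by auto
  fix h g assume "h \<in> (\<lambda>g. g \<otimes> m \<otimes> inv g) ` carrier G" and g: "g \<in> carrier G"
  then obtain k where k: "k \<in> carrier G" "h = k \<otimes> m \<otimes> inv k" by auto
  then have "g \<otimes> h \<otimes> inv g = (g \<otimes> k) \<otimes> m \<otimes> inv (g \<otimes> k)"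
    using g assms by (simp add: m_assoc inv_mult_group)
  then show "g \<otimes> h \<otimes> inv g \<in> (\<lambda>g. g \<otimes> m \<otimes> inv g) ` carrier G"
    by (rule image_eqI) (rule m_closed[OF g k(1)])
qed

lemma finitely_many_conjugates:
  assumes "m \<in> carrier G" "finite X" "carrier G = generate G X"
    and all: "carrier G \<subseteq> generate G ((\<lambda>g. g \<otimes> m \<otimes> inv g) ` carrier G)"
  obtains A where "finite A" "A \<subseteq> carrier G" "carrier G = generate G ((\<lambda>g. g \<otimes> m \<otimes> inv g) ` A)"
proof -
  let ?c = "\<lambda>g. g \<otimes> m \<otimes> inv g"
  have "X \<subseteq> carrier G" unfolding assms(3) by (rule subsetI) (rule generate.incl)
  have "\<exists>B. finite B \<and> B \<subseteq> carrier G \<and> x \<in> generate G (?c ` B)" if "x \<in> X" for x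
    by (rule generate_finite_support) (use that \<open>X \<subseteq> carrier G\<close> all in blast)
  then obtain B where B: "\<And>x. x \<in> X \<Longrightarrow> finite (B x) \<and> B x \<subseteq> carrier G \<and> x \<in> generate G (?c ` B x)"
    by metis
  let ?A = "\<Union>x\<in>X. B x"
  have A: "finite ?A" "?A \<subseteq> carrier G" using B assms(2) by auto
  have cA: "?c ` ?A \<subseteq> carrier G" using A(2) assms(1) by auto
  have "X \<subseteq> generate G (?c ` ?A)"
  proof
    fix x assume x: "x \<in> X"
    have "generate G (?c ` B x) \<subseteq> generate G (?c ` ?A)" using x by (intro mono_generate) blast
    then show "x \<in> generate G (?c ` ?A)" using B[OF x] by blast
  qed
  then have "generate G X \<subseteq> generate G (?c ` ?A)"
    by (rule generate_subgroup_incl[OF _ generate_is_subgroup[OF cA]])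
  then have "carrier G = generate G (?c ` ?A)"
    using generate_incl[OF cA] unfolding assms(3) by (rule subset_antisym)
  with A that show ?thesis by blast
qed

end

section \<open>Geometry of the tubular neighborhood\<close>

text \<open>The difference of the two sides is orthogonal to \<open>T\<close> and, because \<open>T\<close> is the cross product of
  \<open>n\<close> and \<open>T \<times> n\<close>, also has zero cross product with \<open>T\<close>.\<close>

lemma orthonormal_frame_expansion:
  fixes T n v :: "real^3"
  assumes "norm T = 1" "norm n = 1" "n \<bullet> T = 0" "v \<bullet> T = 0"
  shows "v = (v \<bullet> n) *\<^sub>R n + (v \<bullet> cross3 T n) *\<^sub>R cross3 T n"
proof -
  let ?b = "cross3 T n"
  have unit: "T \<bullet> T = 1" "n \<bullet> n = 1" using assms by (simp_all add: dot_square_norm)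
  have "norm ?b = 1"
    using norm_cross_dot[of T n] assms by (simp add: inner_commute power2_eq_1_iff) (smt (verit) norm_ge_zero)
  then have b: "?b \<bullet> ?b = 1" "?b \<bullet> T = 0" "?b \<bullet> n = 0" "n \<bullet> ?b = 0"
    by (simp_all add: dot_square_norm dot_cross_self)
  have T: "T = cross3 n ?b"
    using unit assms(3) Lagrange[of n T n] by (simp add: inner_commute)
  let ?w = "v - ((v \<bullet> n) *\<^sub>R n + (v \<bullet> ?b) *\<^sub>R ?b)"
  have w: "?w \<bullet> n = 0" "?w \<bullet> ?b = 0" "?w \<bullet> T = 0"
    using unit b assms(3,4) by (simp_all add: inner_diff_left inner_add_left)
  have "cross3 ?w (cross3 n ?b) = 0"
    unfolding Lagrange[of ?w n ?b] w(1,2) by simp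
  then have "cross3 ?w T = 0" unfolding T[symmetric] .
  then have "T = 0 \<or> ?w = 0" using w(3) norm_and_cross_eq_0[of ?w T] by auto
  then show ?thesis using assms(1) by auto
qed

lemma norm_frame_combination:
  fixes T n :: "real^3"
  assumes "norm T = 1" "norm n = 1" "n \<bullet> T = 0"
  shows "norm (a *\<^sub>R n + b *\<^sub>R cross3 T n) = norm (Complex a b)"
proof -
  have "norm (cross3 T n) = 1"
    using norm_cross_dot[of T n] assms by (simp add: inner_commute power2_eq_1_iff) (smt (verit) norm_ge_zero)
  then have "orthogonal (a *\<^sub>R n) (b *\<^sub>R cross3 T n)" "norm (cross3 T n) = 1"
    by (auto simp: orthogonal_def dot_cross_self)
  then have "(norm (a *\<^sub>R n + b *\<^sub>R cross3 T n))\<^sup>2 = a\<^sup>2 + b\<^sup>2"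
    using assms(2) by (simp add: norm_add_Pythagorean power_mult_distrib)
  then show ?thesis by (simp add: cmod_def real_sqrt_unique)
qed

locale knot_tube =
  fixes \<kappa> :: "real \<Rightarrow> real^3" and r :: real
  assumes knot: "oriented_knot \<kappa>" and nbhd: "tube_radius \<kappa> r"
begin

abbreviation "K \<equiv> range \<kappa>"
abbreviation "T \<equiv> unit_tangent \<kappa>"
abbreviation "dK x \<equiv> infdist x K"

lemma r_pos: "r > 0" using nbhd by (simp add: tube_radius_def)

lemma derivative:
  obtains D where "continuous_on UNIV D" "\<And>t. (\<kappa> has_vector_derivative D t) (at t)"
    "\<And>t. D t \<noteq> 0" "\<And>t. T t = sgn (D t)"
proof -
  obtain D where D: "D (0::nat) = \<kappa>" "\<And>n t. (D n has_vector_derivative D (Suc n) t) (at t)"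
    using knot unfolding oriented_knot_def smooth_curve_def by blast
  have d: "(\<kappa> has_vector_derivative D 1 t) (at t)" for t using D(2)[of 0 t] D(1) by simp
  have "vector_derivative \<kappa> (at t) = D 1 t" for t using d by (rule vector_derivative_at)
  moreover have "continuous_on UNIV (D 1)"
    using D(2)[of 1] by (meson continuous_at_imp_continuous_on has_vector_derivative_continuous)
  ultimately show ?thesis
    using that[of "D 1"] d knot by (auto simp: oriented_knot_def unit_tangent_def)
qed

lemma continuous_knot: "continuous_on A \<kappa>"
  by (rule derivative) (meson continuous_at_imp_continuous_on has_vector_derivative_continuous)

lemma continuous_tangent: "continuous_on A T"
proof (rule derivative)
  fix D assume D: "continuous_on UNIV D" "\<And>t. D t \<noteq> 0" "\<And>t. T t = sgn (D t)"
  have "continuous_on A (\<lambda>t. sgn (D t))"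
    using D(2) by (intro continuous_intros continuous_on_subset[OF D(1)]) auto
  then show ?thesis using D(3) by (simp cong: continuous_on_cong)
qed

lemma norm_tangent [simp]: "norm (T t) = 1"
  by (rule derivative) (simp add: norm_sgn)

lemma periodic: "\<kappa> (t + of_int n) = \<kappa> t" and tangent_periodic: "T (t + of_int n) = T t"
proof -
  have step: "\<kappa> (t + 1) = \<kappa> t" for t using knot by (simp add: oriented_knot_def)
  have per: "\<kappa> (t + of_int n) = \<kappa> t" for t n
  proof (induction n rule: int_induct[of _ 0])
    case (step1 i) then show ?case using step[of "t + of_int i"] by (simp add: algebra_simps)
  next
    case (step2 i) then show ?case using step[of "t + of_int (i - 1)"] by (simp add: algebra_simps)
  qed simp
  then show "\<kappa> (t + of_int n) = \<kappa> t" .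
  obtain D where D: "\<And>t. (\<kappa> has_vector_derivative D t) (at t)" "\<And>t. T t = sgn (D t)"
    by (rule derivative) blast
  have "((\<lambda>s. s + of_int n) has_vector_derivative 1) (at t)"
    unfolding has_real_derivative_iff_has_vector_derivative[symmetric]
    by (auto intro!: derivative_eq_intros)
  then have "((\<lambda>s. \<kappa> (s + of_int n)) has_vector_derivative D (t + of_int n)) (at t)"
    using vector_diff_chain_at[of "\<lambda>s. s + of_int n" 1 t \<kappa> "D (t + of_int n)"] D(1)
    by (simp add: o_def)
  then have "D (t + of_int n) = D t"
    using vector_derivative_unique_at[OF D(1)[of t]] by (simp add: per)
  then show "T (t + of_int n) = T t" by (simp add: D(2))
qed

lemma knot_param: "\<kappa> (frac t) = \<kappa> t" "T (frac t) = T t"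
  using periodic[of t "- \<lfloor>t\<rfloor>"] tangent_periodic[of t "- \<lfloor>t\<rfloor>"] by (simp_all add: frac_def)

lemma knot_eq_iff: "\<kappa> s = \<kappa> t \<longleftrightarrow> frac s = frac t"
proof
  assume "\<kappa> s = \<kappa> t"
  moreover have "inj_on \<kappa> {0..<1}" using knot by (simp add: oriented_knot_def)
  ultimately show "frac s = frac t"
    using inj_onD[of \<kappa> "{0..<1}" "frac s" "frac t"] by (simp add: knot_param frac_lt_1)
qed (metis knot_param(1))

lemma knot_inj_on: "inj_on \<kappa> {t0 - 1/4..t0 + 1/4}"
proof (rule inj_onI)
  fix s t assume st: "s \<in> {t0 - 1/4..t0 + 1/4}" "t \<in> {t0 - 1/4..t0 + 1/4}" "\<kappa> s = \<kappa> t"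
  then have "frac s = frac t" by (simp add: knot_eq_iff)
  then have "s - t = of_int (\<lfloor>s\<rfloor> - \<lfloor>t\<rfloor>)" by (simp add: frac_def)
  moreover have "\<bar>s - t\<bar> < 1" using st(1,2) by auto
  ultimately have "\<lfloor>s\<rfloor> - \<lfloor>t\<rfloor> = 0" by linarith
  then show "s = t" using \<open>s - t = _\<close> by simp
qed

lemma range_knot: "K = \<kappa> ` {0..1}"
proof -
  have "\<kappa> t \<in> \<kappa> ` {0..1}" for t
    using knot_param(1)[of t] frac_lt_1[of t] by (intro image_eqI[of _ _ "frac t"]) auto
  then show ?thesis by auto
qed

lemma compact_knot: "compact K"
  unfolding range_knot by (intro compact_continuous_image continuous_knot compact_Icc)

lemma closed_knot: "closed K" by (rule compact_imp_closed[OF compact_knot])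

lemma dK_eq_0_iff: "dK x = 0 \<longleftrightarrow> x \<in> K"
  using in_closed_iff_infdist_zero[OF closed_knot] by auto

text \<open>The squared distance from \<open>x\<close> to the knot has a minimum at \<open>t\<close>, so its derivative vanishes.\<close>

lemma nearest_orthogonal:
  assumes "norm (x - \<kappa> t) = dK x" shows "(x - \<kappa> t) \<bullet> T t = 0"
proof -
  obtain D where D: "\<And>t. (\<kappa> has_vector_derivative D t) (at t)" "\<And>t. T t = sgn (D t)"
    by (rule derivative) blast
  let ?f = "\<lambda>s. (x - \<kappa> s) \<bullet> (x - \<kappa> s)"
  have "(?f has_real_derivative - 2 * ((x - \<kappa> t) \<bullet> D t)) (at t)"
    using D(1)[of t] unfolding has_vector_derivative_def has_field_derivative_def
    by (auto intro!: derivative_eq_intros simp: fun_eq_iff inner_commute algebra_simps)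
  moreover have "?f t \<le> ?f s" for s
  proof -
    have "norm (x - \<kappa> t) \<le> norm (x - \<kappa> s)"
      using infdist_le[of "\<kappa> s" K x] assms by (simp add: dist_norm)
    then show ?thesis by (simp add: dot_square_norm power_mono)
  qed
  ultimately have "- 2 * ((x - \<kappa> t) \<bullet> D t) = 0"
    using DERIV_local_min[of ?f "- 2 * ((x - \<kappa> t) \<bullet> D t)" t 1] by simp
  then show "(x - \<kappa> t) \<bullet> T t = 0" by (simp add: D(2) sgn_div_norm)
qed

lemma nearest_point:
  obtains t where "norm (x - \<kappa> t) = dK x" "(x - \<kappa> t) \<bullet> T t = 0"
proof -
  obtain y where "y \<in> K" "dK x = dist x y"
    using infdist_attains_inf[OF closed_knot, of x] by auto
  then obtain t where "norm (x - \<kappa> t) = dK x" by (auto simp: dist_norm)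
  with that nearest_orthogonal show ?thesis by blast
qed

text \<open>Some radius for which the normal disks are still disjoint. That it exceeds \<open>r\<close> makes the boundary of the
  tube accessible from outside and leaves room around the tube for the nearest point map.\<close>

definition R :: real where
  "R = (SOME R. R > r \<and> inj_on (\<lambda>(t, v). \<kappa> t + v)
        {(t, v). 0 \<le> t \<and> t < 1 \<and> v \<bullet> unit_tangent \<kappa> t = 0 \<and> norm v < R})"

lemma R_gt: "r < R" and R_inj: "inj_on (\<lambda>(t, v). \<kappa> t + v)
        {(t, v). 0 \<le> t \<and> t < 1 \<and> v \<bullet> T t = 0 \<and> norm v < R}"
  using someI_ex[of "\<lambda>R. R > r \<and> inj_on (\<lambda>(t, v). \<kappa> t + v)
        {(t, v). 0 \<le> t \<and> t < 1 \<and> v \<bullet> unit_tangent \<kappa> t = 0 \<and> norm v < R}"] nbhd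
  unfolding tube_radius_def R_def by auto

lemma normal_disk_disjoint:
  assumes "\<kappa> s + v = \<kappa> t + w" "v \<bullet> T s = 0" "w \<bullet> T t = 0" "norm v < R" "norm w < R"
  shows "\<kappa> s = \<kappa> t"
proof -
  have "(frac s, v) = (frac t, w)"
    by (rule inj_onD[OF R_inj]) (use assms in \<open>auto simp: knot_param frac_lt_1\<close>)
  then show ?thesis by (simp add: knot_eq_iff)
qed

text \<open>A nearest point of the knot yields a second representation of \<open>\<kappa> t + v\<close> in a normal disk of radius
  less than \<open>R\<close>, which must agree with the given one. Consequently the tube is a metric
  neighborhood of the knot, and the exterior and its retraction can be described by the distance alone.\<close>

lemma dK_normal_disk:
  assumes "v \<bullet> T t = 0" "norm v < R" shows "dK (\<kappa> t + v) = norm v"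
proof -
  obtain s where s: "norm (\<kappa> t + v - \<kappa> s) = dK (\<kappa> t + v)" "(\<kappa> t + v - \<kappa> s) \<bullet> T s = 0"
    by (rule nearest_point)
  have "dK (\<kappa> t + v) \<le> norm v"
    using infdist_le[of "\<kappa> t" K "\<kappa> t + v"] by (simp add: dist_norm)
  then have "\<kappa> s = \<kappa> t"
    using s assms by (intro normal_disk_disjoint[of s "\<kappa> t + v - \<kappa> s" t v]) auto
  then show ?thesis using s(1) by simp
qed

lemma tube_eq: "tube \<kappa> r = {x. dK x \<le> r}"
proof (intro equalityI subsetI)
  fix x assume "x \<in> tube \<kappa> r"
  then show "x \<in> {x. dK x \<le> r}"
    using dK_normal_disk R_gt by (force simp: tube_def)
next
  fix x assume "x \<in> {x. dK x \<le> r}"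
  then show "x \<in> tube \<kappa> r"
    using nearest_point[of x] unfolding tube_def mem_Collect_eq
    by (metis add.commute diff_add_cancel)
qed

lemma exterior_eq: "knot_exterior \<kappa> r = {x. r \<le> dK x}"
proof
  have "closed {x. r \<le> dK x}"
    by (intro closed_Collect_le continuous_intros)
  then show "knot_exterior \<kappa> r \<subseteq> {x. r \<le> dK x}"
    unfolding knot_exterior_def tube_eq by (intro closure_minimal) auto
  show "{x. r \<le> dK x} \<subseteq> knot_exterior \<kappa> r"
  proof
    fix x assume "x \<in> {x. r \<le> dK x}"
    then consider "dK x > r" | "dK x = r" by fastforce
    then show "x \<in> knot_exterior \<kappa> r"
    proof cases
      case 1
      then show ?thesis
        unfolding knot_exterior_def tube_eq by (intro subsetD[OF closure_subset]) auto
    next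
      case 2
      obtain t where t: "norm (x - \<kappa> t) = r" "(x - \<kappa> t) \<bullet> T t = 0"
        using nearest_point[of x] 2 by metis
      show ?thesis
        unfolding knot_exterior_def tube_eq closure_approachable
      proof (intro allI impI)
        fix e :: real assume "e > 0"
        obtain q where q: "q > 0" "q < e" "q < R - r"
          using dense[of 0 "min e (R - r)"] R_gt \<open>e > 0\<close> by auto
        define \<delta> where "\<delta> = q / r"
        have \<delta>: "\<delta> > 0" "\<delta> * r < e" "(1 + \<delta>) * r < R"
          using q r_pos by (auto simp: \<delta>_def distrib_right)
        let ?y = "\<kappa> t + (1 + \<delta>) *\<^sub>R (x - \<kappa> t)"
        have "dK ?y = norm ((1 + \<delta>) *\<^sub>R (x - \<kappa> t))"
          using t \<delta> by (intro dK_normal_disk) auto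
        then have "dK ?y = (1 + \<delta>) * r" using t(1) \<delta>(1) by simp
        also have "\<dots> > r" using \<delta>(1) r_pos by (simp add: algebra_simps)
        finally have "?y \<in> - {x. dK x \<le> r}" by simp
        moreover have "dist ?y x = norm (\<delta> *\<^sub>R (x - \<kappa> t))"
          by (simp add: dist_norm algebra_simps)
        then have "dist ?y x < e" using t(1) \<delta> by simp
        ultimately show "\<exists>y\<in>- {x. dK x \<le> r}. dist y x < e" by blast
      qed
    qed
  qed
qed

text \<open>A choice of nearest point, which is unique at distance less than \<open>R\<close>.\<close>

definition foot :: "real^3 \<Rightarrow> real^3" where
  "foot x = (SOME y. y \<in> K \<and> dist x y = dK x)"

lemma foot: "foot x \<in> K" "dist x (foot x) = dK x"
proof -
  obtain y where "y \<in> K" "dK x = dist x y"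
    using infdist_attains_inf[OF closed_knot, of x] by blast
  then have "y \<in> K \<and> dist x y = dK x" by simp
  then have "foot x \<in> K \<and> dist x (foot x) = dK x" unfolding foot_def by (rule someI)
  then show "foot x \<in> K" "dist x (foot x) = dK x" by (rule conjunct1, rule conjunct2)
qed

lemma foot_unique:
  assumes "dK x < R" "y \<in> K" "dist x y = dK x" shows "y = foot x"
proof -
  obtain s t where st: "y = \<kappa> s" "foot x = \<kappa> t" using assms(2) foot(1)[of x] by auto
  then have "norm (x - \<kappa> s) = dK x" "norm (x - \<kappa> t) = dK x"
    using assms(3) foot(2)[of x] by (auto simp: dist_norm)
  then show ?thesis
    unfolding st using assms(1) nearest_orthogonal
    by (intro normal_disk_disjoint[of s "x - \<kappa> s" t "x - \<kappa> t"]) auto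
qed

text \<open>The graph is closed and the knot is compact.\<close>

lemma continuous_foot: assumes "R' < R" shows "continuous_on {x. dK x \<le> R'} foot"
proof (rule continuous_from_closed_graph[OF compact_knot])
  show "foot \<in> {x. dK x \<le> R'} \<rightarrow> K" using foot(1) by auto
  have "(\<lambda>x. (x, foot x)) ` {x. dK x \<le> R'}
      = {z. dK (fst z) \<le> R'} \<inter> (UNIV \<times> K) \<inter> {z. dist (fst z) (snd z) = dK (fst z)}"
  proof (rule Set.set_eqI)
    fix z :: "(real^3) \<times> (real^3)"
    obtain x y where z: "z = (x, y)" by (cases z)
    have "y = foot x \<longleftrightarrow> y \<in> K \<and> dist x y = dK x" if "dK x \<le> R'"
      using foot[of x] foot_unique[of x y] that assms by fastforce
    then show "z \<in> (\<lambda>x. (x, foot x)) ` {x. dK x \<le> R'} \<longleftrightarrow> z \<in> {z. dK (fst z) \<le> R'}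
        \<inter> (UNIV \<times> K) \<inter> {z. dist (fst z) (snd z) = dK (fst z)}"
      unfolding z
      by (auto simp only: image_iff mem_Collect_eq Int_iff mem_Sigma_iff fst_conv snd_conv UNIV_I Pair_inject)
  qed
  moreover have "closed \<dots>"
    by (intro closed_Int closed_Times closed_knot closed_UNIV closed_Collect_le closed_Collect_eq continuous_intros)
  ultimately show "closed ((\<lambda>x. (x, foot x)) ` {x. dK x \<le> R'})" by simp
qed

definition push_out :: "real^3 \<Rightarrow> real^3" where
  "push_out x = (if dK x \<le> r then foot x + (r / dK x) *\<^sub>R (x - foot x) else x)"

lemma retraction_exterior:
  shows "continuous_on (- K) push_out" "push_out \<in> - K \<rightarrow> knot_exterior \<kappa> r"
    and "\<And>x. x \<in> knot_exterior \<kappa> r \<Longrightarrow> push_out x = x"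
proof -
  have pos: "dK x > 0" if "x \<in> - K" for x
    using that dK_eq_0_iff[of x] infdist_nonneg[of x K] by auto
  have c: "continuous_on {x \<in> - K. dK x \<le> r} foot"
    by (rule continuous_on_subset[OF continuous_foot[OF R_gt]]) auto
  show "continuous_on (- K) push_out"
    unfolding push_out_def
  proof (rule continuous_on_cases_le)
    show "continuous_on {x \<in> - K. dK x \<le> r} (\<lambda>x. foot x + (r / dK x) *\<^sub>R (x - foot x))"
      using pos by (intro continuous_intros c) (auto simp: dK_eq_0_iff)
  qed (use r_pos in \<open>auto intro!: continuous_intros\<close>)
  show "push_out \<in> - K \<rightarrow> knot_exterior \<kappa> r"
  proof
    fix x assume x: "x \<in> - K"
    show "push_out x \<in> knot_exterior \<kappa> r"
    proof (cases "dK x \<le> r")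
      case True
      obtain t where t: "foot x = \<kappa> t" using foot(1)[of x] by auto
      then have n: "norm (x - \<kappa> t) = dK x" using foot(2)[of x] by (simp add: dist_norm)
      let ?v = "(r / dK x) *\<^sub>R (x - \<kappa> t)"
      have nv: "norm ?v = r" using n pos[OF x] r_pos by simp
      have "dK (\<kappa> t + ?v) = norm ?v"
        using nv R_gt nearest_orthogonal[OF n] by (intro dK_normal_disk) auto
      then show ?thesis using True nv by (simp add: exterior_eq push_out_def t)
    qed (simp add: exterior_eq push_out_def)
  qed
  show "push_out x = x" if "x \<in> knot_exterior \<kappa> r" for x
    using that r_pos by (cases "dK x = r") (auto simp: exterior_eq push_out_def)
qed

text \<open>On the compact set of parameter pairs at distance between \<open>1/4\<close> and \<open>3/4\<close> modulo 1, injectivity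
  bounds the distance of the corresponding knot points away from 0.\<close>

lemma nearby_parameters:
  obtains \<eta> where "\<eta> > 0"
    "\<And>t t0. norm (\<kappa> t - \<kappa> t0) < \<eta> \<Longrightarrow> \<exists>s\<in>{t0 - 1/4..t0 + 1/4}. \<kappa> s = \<kappa> t"
proof -
  let ?A = "{0..1::real} \<times> {1/4..3/4::real}"
  have "\<kappa> (t0 + u) \<noteq> \<kappa> t0" if "u \<in> {1/4..3/4}" for t0 u :: real
  proof
    assume "\<kappa> (t0 + u) = \<kappa> t0"
    then have "u = of_int (\<lfloor>t0 + u\<rfloor> - \<lfloor>t0\<rfloor>)" by (simp add: knot_eq_iff frac_def)
    then obtain k :: int where "u = of_int k" by blast
    moreover from this have "k > 0" "k < 1" using that by auto
    ultimately show False by linarith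
  qed
  moreover have "continuous_on ?A (\<lambda>(t0, u). norm (\<kappa> (t0 + u) - \<kappa> t0))"
    unfolding case_prod_unfold
    by (intro continuous_intros continuous_on_compose2[OF continuous_knot[of UNIV]]) auto
  moreover have "compact ?A" "?A \<noteq> {}" by (auto intro!: compact_Times)
  ultimately obtain \<eta> where \<eta>: "\<eta> > 0" "\<And>t0 u. t0 \<in> {0..1} \<Longrightarrow> u \<in> {1/4..3/4} \<Longrightarrow> \<eta> \<le> norm (\<kappa> (t0 + u) - \<kappa> t0)"
  proof -
    assume a: "\<And>u t0. u \<in> {1/4..3/4} \<Longrightarrow> \<kappa> (t0 + u) \<noteq> \<kappa> t0"
      and b: "continuous_on ?A (\<lambda>(t0, u). norm (\<kappa> (t0 + u) - \<kappa> t0))" "compact ?A" "?A \<noteq> {}"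
    obtain z where z: "z \<in> ?A" "\<And>y. y \<in> ?A \<Longrightarrow> (\<lambda>(t0, u). norm (\<kappa> (t0 + u) - \<kappa> t0)) z \<le> (\<lambda>(t0, u). norm (\<kappa> (t0 + u) - \<kappa> t0)) y"
      using continuous_attains_inf[OF b(2,3,1)] by blast
    obtain z1 z2 where zz: "z = (z1, z2)" by (cases z)
    show ?thesis
      using z a[of z2 z1] by (intro that[of "norm (\<kappa> (z1 + z2) - \<kappa> z1)"]) (auto simp: zz)
  qed
  show ?thesis
  proof (rule that[OF \<eta>(1)])
    fix t t0 assume less: "norm (\<kappa> t - \<kappa> t0) < \<eta>"
    define n where "n = \<lfloor>t - t0 + 1/4\<rfloor>"
    define u where "u = t - t0 - of_int n"
    have u: "-1/4 \<le> u" "u < 3/4" unfolding u_def n_def by linarith+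
    have ku: "\<kappa> (t0 + u) = \<kappa> t" using periodic[of t "- n"] by (simp add: u_def)
    have kf: "\<kappa> (frac t0 + u) = \<kappa> (t0 + u)"
      using periodic[of "t0 + u" "- \<lfloor>t0\<rfloor>"] by (simp add: frac_def algebra_simps)
    have "\<not> u \<ge> 1/4"
      using \<eta>(2)[of "frac t0" u] u less frac_lt_1[of t0] by (auto simp: kf ku knot_param)
    then show "\<exists>s\<in>{t0 - 1/4..t0 + 1/4}. \<kappa> s = \<kappa> t"
      using u ku by (intro bexI[of _ "t0 + u"]) auto
  qed
qed

text \<open>This cone is a differentiable image of the plane in space.\<close>

lemma negligible_knot_cone: "negligible ((\<lambda>(s, t). f + s *\<^sub>R (\<kappa> t - f)) ` UNIV)"
proof -
  obtain D where D: "\<And>t. (\<kappa> has_vector_derivative D t) (at t)" by (rule derivative) blast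
  then have "\<kappa> differentiable at t" for t
    by (meson differentiableI_vector)
  then have "(\<lambda>z. \<kappa> (snd z)) differentiable at z" for z :: "real \<times> real"
    using differentiable_chain_at[of snd z \<kappa>] by (auto simp: o_def intro: bounded_linear_imp_differentiable bounded_linear_snd)
  then have "(\<lambda>z. f + fst z *\<^sub>R (\<kappa> (snd z) - f)) differentiable at z" for z :: "real \<times> real"
    by (intro derivative_intros) (auto intro: bounded_linear_imp_differentiable bounded_linear_fst)
  then show ?thesis
    unfolding case_prod_unfold
    by (intro negligible_differentiable_image_lowdim) (auto simp: differentiable_on_def intro: differentiable_at_withinI)
qed

text \<open>If the segment from \<open>a\<close> to \<open>f\<close> meets the knot, then \<open>a\<close> lies on the cone over the knot with
  apex \<open>f\<close>. A ball is not covered by finitely many such null sets. The cone with apex 0 also contains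
  the knot itself and keeps \<open>a\<close> off it.\<close>

lemma generic_point:
  assumes "finite F" "F \<subseteq> - K" "\<delta> > 0"
  shows "\<exists>a\<in>- K. dist a y < \<delta> \<and> (\<forall>f\<in>F. closed_segment a f \<subseteq> - K)"
proof -
  let ?cone = "\<lambda>f. (\<lambda>(s, t). f + s *\<^sub>R (\<kappa> t - f)) ` UNIV"
  have "negligible (\<Union>f\<in>insert 0 F. ?cone f)"
    using assms(1) by (intro negligible_Union finite_imageI finite_insert[THEN iffD2])
      (blast intro: negligible_knot_cone)+
  moreover have "\<not> negligible (ball y \<delta>)"
    using assms(3) by (intro open_not_negligible) auto
  ultimately have "\<not> ball y \<delta> \<subseteq> (\<Union>f\<in>insert 0 F. ?cone f)"
    using negligible_subset by blast
  then obtain a where a: "a \<in> ball y \<delta>" "\<And>f. f \<in> insert 0 F \<Longrightarrow> a \<notin> ?cone f"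
    unfolding subset_iff UN_iff by blast
  have cone: "f + s *\<^sub>R (\<kappa> t - f) \<in> ?cone f" for f s t
    by (rule image_eqI[of _ _ "(s, t)"]) simp_all
  have notK: "a \<in> - K" using a(2)[of 0] cone[of 0 1] by auto
  have "closed_segment a f \<subseteq> - K" if f: "f \<in> F" for f
  proof (rule subsetI, rule ComplI)
    fix x assume "x \<in> closed_segment a f" and xK: "x \<in> K"
    then have "x \<in> closed_segment f a" by (simp only: closed_segment_commute)
    with xK obtain u t where x: "x = (1 - u) *\<^sub>R f + u *\<^sub>R a" "x = \<kappa> t"
      unfolding closed_segment_def by blast
    have "u \<noteq> 0" using x(1) xK f assms(2) by auto
    moreover have "x - f = u *\<^sub>R (a - f)" using x(1) by (simp add: algebra_simps)
    ultimately have "a = f + (1 / u) *\<^sub>R (\<kappa> t - f)" using x(2) by simp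
    then show False using a(2)[of f] f cone[of f "1 / u" t] by simp
  qed
  then show ?thesis using a(1) notK by (intro bexI[of _ a]) (auto simp: dist_commute)
qed

lemma path_connected_complement: "path_connected (- K)"
  unfolding path_connected_def
proof (intro ballI)
  fix x y assume "x \<in> - K" "y \<in> - K"
  then obtain a where "closed_segment a x \<subseteq> - K" "closed_segment a y \<subseteq> - K"
    using generic_point[of "{x, y}" 1 0] by auto
  then have "path_in (- K) x y (linepath x a +++ linepath a y)"
    by (intro path_in_join[of _ x a _ y] path_in_linepath) (auto simp: closed_segment_commute)
  then show "\<exists>g. path g \<and> path_image g \<subseteq> - K \<and> pathstart g = x \<and> pathfinish g = y"
    unfolding path_in_def by blast
qed

end

section \<open>Small loops and meridians\<close>

locale framed_knot_tube = knot_tube +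
  fixes \<nu> :: "real \<Rightarrow> real^3"
  assumes continuous_frame: "continuous_on UNIV \<nu>" and normal_frame: "\<And>t. unit_normal \<kappa> t (\<nu> t)"
begin

text \<open>The universal covering of the tube without its core: \<open>(t, g)\<close> goes to the point of the normal disk
  at \<open>\<kappa> t\<close> with complex coordinate \<open>exp g\<close> in the frame \<open>(\<nu>, T \<times> \<nu>)\<close>. Its domain \<open>L\<close> is convex, and
  \<open>turn k\<close> is the deck translation that winds \<open>k\<close> times around the core.\<close>

definition tube_map :: "real \<times> complex \<Rightarrow> real^3" where
  "tube_map w = \<kappa> (fst w) + (Re (exp (snd w)) *\<^sub>R \<nu> (fst w)
      + Im (exp (snd w)) *\<^sub>R cross3 (T (fst w)) (\<nu> (fst w)))"

abbreviation "L \<equiv> (UNIV :: real set) \<times> {g. Re g < ln R}"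

abbreviation turn :: "int \<Rightarrow> real \<times> complex" where
  "turn k \<equiv> (0, of_int k * (2 * of_real pi * \<i>))"

lemma frame: "norm (\<nu> t) = 1" "\<nu> t \<bullet> T t = 0"
  using normal_frame[of t] by (auto simp: unit_normal_def)

lemma R_pos: "R > 0" using r_pos R_gt by simp

lemma convex_L: "convex L"
  by (intro convex_Times convex_UNIV) (simp add: convex_halfspace_Re_lt)

lemma continuous_tube_map: "continuous_on A tube_map"
  unfolding tube_map_def
  by (intro continuous_intros continuous_on_cross continuous_on_compose2[OF continuous_knot[of UNIV]]
      continuous_on_compose2[OF continuous_frame] continuous_on_compose2[OF continuous_tangent[of UNIV]]) auto

lemma dK_tube_map: "w \<in> L \<Longrightarrow> dK (tube_map w) = exp (Re (snd w))"
proof -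
  assume w: "w \<in> L"
  let ?t = "fst w" and ?z = "exp (snd w)"
  let ?v = "Re ?z *\<^sub>R \<nu> ?t + Im ?z *\<^sub>R cross3 (T ?t) (\<nu> ?t)"
  have n: "norm ?v = exp (Re (snd w))"
    using norm_frame_combination[of "T ?t" "\<nu> ?t" "Re ?z" "Im ?z"] by (simp add: frame)
  also have "\<dots> < exp (ln R)" using w unfolding exp_less_cancel_iff by (simp add: mem_Times_iff)
  also have "\<dots> = R" using R_pos by (rule exp_ln)
  finally have "norm ?v < R" .
  moreover have "?v \<bullet> T ?t = 0" using frame(2) by (simp add: inner_add_left dot_cross_self)
  ultimately have "dK (\<kappa> ?t + ?v) = norm ?v" by (intro dK_normal_disk)
  then show ?thesis using n by (simp add: tube_map_def)
qed

lemma tube_map_complement: "tube_map \<in> L \<rightarrow> - K"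
proof
  fix w assume "w \<in> L"
  then have "dK (tube_map w) \<noteq> 0" by (simp add: dK_tube_map)
  then show "tube_map w \<in> - K" by (simp add: dK_eq_0_iff)
qed

lemma tube_map_turn: "tube_map (w + turn k) = tube_map w"
proof -
  have "exp (snd w + of_int k * (2 * of_real pi * \<i>)) = exp (snd w)"
    using exp_plus_2pin[of "snd w" k] by (simp add: mult_ac)
  then show ?thesis by (simp add: tube_map_def)
qed

text \<open>Close to \<open>\<kappa> t0\<close> the nearest point map followed by a local inverse of \<open>\<kappa>\<close> gives a continuous longitudinal
  coordinate, which closes up along the loop. The coordinate in the normal disk has no zeros, so it has a
  continuous logarithm, which closes up only modulo \<open>2\<pi>i\<close>.\<close>

lemma lift_small_loop:
  obtains \<rho> where "\<rho> > 0"
    "\<And>t0 a q. path_in (- K \<inter> ball (\<kappa> t0) \<rho>) a a q \<Longrightarrow>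
      \<exists>Q u k. path_in L u (u + turn k) Q \<and> (\<forall>s\<in>{0..1}. q s = tube_map (Q s))"
proof -
  obtain \<eta> where \<eta>: "\<eta> > 0"
    "\<And>t t0. norm (\<kappa> t - \<kappa> t0) < \<eta> \<Longrightarrow> \<exists>s\<in>{t0 - 1/4..t0 + 1/4}. \<kappa> s = \<kappa> t"
    by (rule nearby_parameters) blast
  define \<rho> where "\<rho> = min (\<eta> / 2) r"
  have \<rho>: "\<rho> > 0" "2 * \<rho> \<le> \<eta>" "\<rho> \<le> r" using \<eta>(1) r_pos by (auto simp: \<rho>_def)
  show ?thesis
  proof (rule that[OF \<rho>(1)])
    fix t0 a q assume q: "path_in (- K \<inter> ball (\<kappa> t0) \<rho>) a a q"
    let ?I = "{t0 - 1/4..t0 + 1/4}"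
    have qK: "q s \<notin> K" "dist (\<kappa> t0) (q s) < \<rho>" if "s \<in> {0..1}" for s
    proof -
      have "q s \<in> - K \<inter> ball (\<kappa> t0) \<rho>"
        using q that unfolding path_in_def path_image_def by blast
      then show "q s \<notin> K" "dist (\<kappa> t0) (q s) < \<rho>" by simp_all
    qed
    have dq: "dK (q s) < \<rho>" if "s \<in> {0..1}" for s
      using infdist_le[of "\<kappa> t0" K "q s"] qK(2)[OF that] by (simp add: dist_commute)
    have cq: "continuous_on {0..1} q" using q by (simp add: path_in_def path_def)
    have prI: "foot (q s) \<in> \<kappa> ` ?I" if "s \<in> {0..1}" for s
    proof -
      obtain t where t: "foot (q s) = \<kappa> t" using foot(1) by blast
      have "norm (\<kappa> t - \<kappa> t0) \<le> dist (q s) (foot (q s)) + dist (\<kappa> t0) (q s)"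
        unfolding t using dist_triangle[of "\<kappa> t" "\<kappa> t0" "q s"] by (simp add: dist_norm norm_minus_commute)
      also have "\<dots> < \<eta>" using foot(2)[of "q s"] dq[OF that] qK(2)[OF that] \<rho>(2) by simp
      finally obtain u where "u \<in> ?I" "\<kappa> u = \<kappa> t" using \<eta>(2) by blast
      then show ?thesis using t by (intro image_eqI[of _ _ u]) simp_all
    qed
    have cpr: "continuous_on {0..1} (\<lambda>s. foot (q s))"
    proof (rule continuous_on_compose2[OF continuous_foot[OF R_gt] cq])
      show "q ` {0..1} \<subseteq> {x. dK x \<le> r}" using dq \<rho>(3) by fastforce
    qed
    define h where "h = inv_into ?I \<kappa>"
    have ch: "continuous_on (\<kappa> ` ?I) h"
      unfolding h_def
      by (rule continuous_on_inv[OF continuous_knot compact_Icc]) (auto simp: inv_into_f_f[OF knot_inj_on])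
    define t where "t = (\<lambda>s. h (foot (q s)))"
    have ct: "continuous_on {0..1} t"
      unfolding t_def using prI by (intro continuous_on_compose2[OF ch cpr]) auto
    have kt: "\<kappa> (t s) = foot (q s)" if "s \<in> {0..1}" for s
      unfolding t_def h_def by (rule f_inv_into_f[OF prI[OF that]])
    define v where "v = (\<lambda>s. q s - \<kappa> (t s))"
    have cv: "continuous_on {0..1} v"
      unfolding v_def by (intro continuous_intros cq continuous_on_compose2[OF continuous_knot[of UNIV] ct]) auto
    have nv: "norm (v s) = dK (q s)" if "s \<in> {0..1}" for s
      using foot(2)[of "q s"] kt[OF that] by (simp add: v_def dist_norm)
    have vT: "v s \<bullet> T (t s) = 0" if "s \<in> {0..1}" for s
      using nearest_orthogonal[of "q s" "t s"] nv[OF that] by (simp add: v_def)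
    define z where "z = (\<lambda>s. Complex (v s \<bullet> \<nu> (t s)) (v s \<bullet> cross3 (T (t s)) (\<nu> (t s))))"
    have cz: "continuous_on {0..1} z"
      unfolding z_def
      by (intro continuous_on_Complex continuous_on_inner continuous_on_cross cv
          continuous_on_compose2[OF continuous_frame ct] continuous_on_compose2[OF continuous_tangent[of UNIV] ct]) auto
    have vz: "v s = Re (z s) *\<^sub>R \<nu> (t s) + Im (z s) *\<^sub>R cross3 (T (t s)) (\<nu> (t s))" if "s \<in> {0..1}" for s
      using orthonormal_frame_expansion[OF norm_tangent frame vT[OF that]] by (simp add: z_def)
    have nz: "norm (z s) = dK (q s)" if "s \<in> {0..1}" for s
      using norm_frame_combination[of "T (t s)" "\<nu> (t s)" "Re (z s)" "Im (z s)"] vz[OF that] nv[OF that]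
      by (simp add: frame)
    have z0: "z s \<noteq> 0" if "s \<in> {0..1}" for s
      using nz[OF that] qK(1)[OF that] dK_eq_0_iff by force
    obtain g where g: "continuous_on {0..1} g" "\<And>s. s \<in> {0..1} \<Longrightarrow> z s = exp (g s)"
      using continuous_logarithm_on_contractible[OF cz] z0 by (metis convex_imp_contractible convex_real_interval(5))
    have qQ: "q s = tube_map (t s, g s)" if "s \<in> {0..1}" for s
      using vz[OF that] g(2)[OF that] by (simp add: tube_map_def v_def algebra_simps)
    have "q 0 = q 1" using q by (simp add: path_in_def pathstart_def pathfinish_def)
    then have tz: "t 0 = t 1" "z 0 = z 1" by (simp_all add: t_def z_def v_def)
    then have "exp (g 1) = exp (g 0)" using g(2)[of 0] g(2)[of 1] by simp
    then obtain k :: int where k: "g 1 = g 0 + (of_int (2 * k) * pi) * \<i>"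
      using exp_eq by blast
    have "Re (g s) < ln R" if "s \<in> {0..1}" for s
    proof -
      have "exp (Re (g s)) = dK (q s)" using nz[OF that] g(2)[OF that] by simp
      also have "\<dots> < R" using dq[OF that] \<rho>(3) R_gt by simp
      finally show ?thesis using R_pos by (metis exp_less_cancel_iff exp_ln)
    qed
    then have "path_in L (t 0, g 0) ((t 0, g 0) + turn k) (\<lambda>s. (t s, g s))"
      using tz(1) k ct g(1)
      by (auto simp: path_in_def path_def path_image_def pathstart_def pathfinish_def algebra_simps
          intro!: continuous_on_Pair)
    with qQ show "\<exists>Q u k. path_in L u (u + turn k) Q \<and> (\<forall>s\<in>{0..1}. q s = tube_map (Q s))"
      by (intro exI[of _ "\<lambda>s. (t s, g s)"] exI[of _ "(t 0, g 0)"] exI[of _ k]) auto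
  qed
qed

lemma meridian_loop_eq: "tube_map \<circ> linepath (0, of_real (ln r)) ((0, of_real (ln r)) + turn 1) = meridian_loop \<kappa> r (\<nu> 0)"
proof
  fix s :: real
  have e: "exp (of_real (ln r) + of_real (2 * pi * s) * \<i>) = of_real r * cis (2 * pi * s)"
    using r_pos by (simp add: exp_add cis_conv_exp mult.commute exp_of_real)
  have "linepath (0::real, complex_of_real (ln r)) ((0, of_real (ln r)) + turn 1) s
      = (0, of_real (ln r) + of_real (2 * pi * s) * \<i>)"
    by (simp add: linepath_def algebra_simps scaleR_conv_of_real)
  moreover have "tube_map (0, of_real (ln r) + of_real (2 * pi * s) * \<i>) = meridian_loop \<kappa> r (\<nu> 0) s"
    unfolding tube_map_def fst_conv snd_conv e by (simp add: meridian_loop_def scaleR_add_right)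
  ultimately show "(tube_map \<circ> linepath (0, of_real (ln r)) ((0, of_real (ln r)) + turn 1)) s = meridian_loop \<kappa> r (\<nu> 0) s"
    by (simp only: o_apply)
qed

lemma mu_L: "(0, of_real (ln r)) \<in> L"
  using r_pos R_gt by simp

lemma L_turn: "w \<in> L \<Longrightarrow> w + turn k \<in> L"
  by (cases w) simp

text \<open>In the convex domain of \<open>tube_map\<close> the holonomy \<open>\<psi>\<close> of an image path depends only on the ends and is invariant
  under deck translations. A small loop lifts to a path from \<open>u\<close> to \<open>u + turn k\<close>; moving \<open>u\<close> to the base
  point \<open>ln r\<close> turns its holonomy into the \<open>k\<close>-th power of that of the meridian,
  which is trivial.\<close>

lemma small_loops_trivial:
  assumes "holonomy Q (- K) \<phi>" and mer: "\<phi> (meridian_loop \<kappa> r (\<nu> 0)) = \<one>\<^bsub>Q\<^esub>"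
  shows "\<exists>\<epsilon>>0. \<forall>y. holonomy.trivial_on Q (- K) \<phi> (ball y \<epsilon>)"
proof -
  interpret holonomy Q "- K" \<phi> by fact
  define \<psi> where "\<psi> = (\<lambda>u v. \<phi> (tube_map \<circ> linepath u v))"
  have push: "path_in (- K) (tube_map u) (tube_map v) (tube_map \<circ> p)" if "path_in L u v p" for u v p
    by (rule path_in_image[OF that continuous_tube_map tube_map_complement])
  have lp: "path_in L u v (linepath u v)" if "u \<in> L" "v \<in> L" for u v
    by (rule path_in_linepath[OF closed_segment_subset[OF that convex_L]])
  have \<psi>: "\<phi> (tube_map \<circ> p) = \<psi> u v" if p: "path_in L u v p" for u v p
    unfolding \<psi>_def using path_in_endpoints[OF p]
    by (intro homotopic homotopic_paths_continuous_image[OF homotopic_paths_convex[OF p lp convex_L]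
          continuous_tube_map tube_map_complement]) auto
  have \<psi>_closed: "\<psi> u v \<in> carrier Q" if "u \<in> L" "v \<in> L" for u v
    unfolding \<psi>_def by (rule closed[OF push[OF lp[OF that]]])
  have \<psi>_mult: "\<psi> u v \<otimes>\<^bsub>Q\<^esub> \<psi> v w = \<psi> u w" if "u \<in> L" "v \<in> L" "w \<in> L" for u v w
    using join[OF push[OF lp[OF that(1,2)]] push[OF lp[OF that(2,3)]]]
      \<psi>[OF path_in_join[OF lp[OF that(1,2)] lp[OF that(2,3)]]]
    by (simp add: \<psi>_def path_compose_join)
  have \<psi>_self: "\<psi> u u = \<one>\<^bsub>Q\<^esub>" if "u \<in> L" for u
    using \<psi>_mult[OF that that that] \<psi>_closed[OF that that] by (simp add: r_cancel_one')
  have \<psi>_turn: "\<psi> (u + turn k) (v + turn k) = \<psi> u v" for u v k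
  proof -
    have "linepath (u + turn k) (v + turn k) s = linepath u v s + turn k" for s
      by (simp add: linepath_def algebra_simps flip: scaleR_add_left)
    then have "tube_map \<circ> linepath (u + turn k) (v + turn k) = tube_map \<circ> linepath u v"
      by (simp add: fun_eq_iff tube_map_turn)
    then show ?thesis by (simp add: \<psi>_def)
  qed
  let ?m = "(0, of_real (ln r)) :: real \<times> complex"
  note mL = mu_L
  have one: "\<psi> ?m (?m + turn 1) = \<one>\<^bsub>Q\<^esub>"
    using mer unfolding \<psi>_def meridian_loop_eq .
  have turn_Suc: "(w + turn k) + turn 1 = w + turn (k + 1)" for w k
    by (cases w) (simp add: algebra_simps)
  have shift: "\<psi> ?m (?m + turn (k + 1)) = \<psi> ?m (?m + turn k)" for k
  proof -
    have "\<psi> (?m + turn k) (?m + turn (k + 1)) = \<psi> ?m (?m + turn 1)"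
      using \<psi>_turn[of ?m k "?m + turn 1"] turn_Suc[of ?m k] by (simp add: add_ac)
    then show ?thesis
      using \<psi>_mult[OF mL L_turn[OF mL] L_turn[OF mL], of k "k + 1"] one \<psi>_closed[OF mL L_turn[OF mL]]
      by simp
  qed
  have all: "\<psi> ?m (?m + turn k) = \<one>\<^bsub>Q\<^esub>" for k
  proof (induction k rule: int_induct[of _ 0])
    case base show ?case using \<psi>_self[OF mL] by simp
  next
    case (step1 i) then show ?case using shift[of i] by simp
  next
    case (step2 i) then show ?case using shift[of "i - 1"] by simp
  qed
  have lifted: "\<psi> u (u + turn k) = \<one>\<^bsub>Q\<^esub>" if u: "u \<in> L" for u k
  proof -
    have "\<psi> u (u + turn k) = \<psi> u ?m \<otimes>\<^bsub>Q\<^esub> (\<psi> ?m (?m + turn k) \<otimes>\<^bsub>Q\<^esub> \<psi> (?m + turn k) (u + turn k))"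
      using \<psi>_mult u mL L_turn by simp
    also have "\<dots> = \<psi> u ?m \<otimes>\<^bsub>Q\<^esub> \<psi> ?m u"
      unfolding all \<psi>_turn by (simp only: l_one[OF \<psi>_closed[OF mL u]])
    also have "\<dots> = \<one>\<^bsub>Q\<^esub>" using \<psi>_mult[OF u mL u] \<psi>_self[OF u] by simp
    finally show ?thesis .
  qed
  obtain \<rho> where \<rho>: "\<rho> > 0" "\<And>t0 a q. path_in (- K \<inter> ball (\<kappa> t0) \<rho>) a a q \<Longrightarrow>
      \<exists>Q u k. path_in L u (u + turn k) Q \<and> (\<forall>s\<in>{0..1}. q s = tube_map (Q s))"
    by (rule lift_small_loop) blast
  have "trivial_on (ball y (\<rho> / 2))" for y
  proof (cases "dK y < \<rho> / 2")
    case False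
    have "x \<notin> K" if "x \<in> ball y (\<rho> / 2)" for x
      using infdist_le[of x K y] that False by auto
    then have "ball y (\<rho> / 2) \<subseteq> - K" by blast
    then show ?thesis by (intro trivial_on_convex) auto
  next
    case True
    obtain t0 where t0: "foot y = \<kappa> t0" using foot(1)[of y] by auto
    have near: "dist (\<kappa> t0) y < \<rho> / 2" using foot(2)[of y] True t0 by (simp add: dist_commute)
    have sub: "ball y (\<rho> / 2) \<subseteq> ball (\<kappa> t0) \<rho>"
    proof
      fix x assume "x \<in> ball y (\<rho> / 2)"
      then show "x \<in> ball (\<kappa> t0) \<rho>" using near dist_triangle[of "\<kappa> t0" x y] by simp
    qed
    show ?thesis
      unfolding trivial_on_def
    proof (intro allI impI)
      fix a q assume "path_in (- K \<inter> ball y (\<rho> / 2)) a a q"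
      then have q: "path_in (- K \<inter> ball (\<kappa> t0) \<rho>) a a q" by (rule path_in_mono) (use sub in blast)
      then obtain Q' u k where Q: "path_in L u (u + turn k) Q'" "\<And>s. s \<in> {0..1} \<Longrightarrow> q s = tube_map (Q' s)"
        using \<rho>(2) by metis
      have "homotopic_paths (- K) q (tube_map \<circ> Q')"
        using q Q(2) by (intro homotopic_paths_eq) (auto simp: path_in_def)
      then have "\<phi> q = \<psi> u (u + turn k)" using homotopic \<psi>[OF Q(1)] by simp
      then show "\<phi> q = \<one>\<^bsub>Q\<^esub>" using lifted path_in_endpoints[OF Q(1)] by simp
    qed
  qed
  then show ?thesis using \<rho>(1) by (intro exI[of _ "\<rho> / 2"]) auto
qed

text \<open>The exterior is not compact. Outside a large ball, points move along rays to the sphere, which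
  keeps them at distance at least \<open>r\<close> from the knot.\<close>

lemma push_into_ball:
  assumes "\<And>y. y \<in> K \<Longrightarrow> norm y + r < M" and M: "norm b \<le> M"
    and p: "path_in (knot_exterior \<kappa> r) b b p"
  shows "\<exists>p'. path_in (knot_exterior \<kappa> r \<inter> cball 0 M) b b p' \<and> homotopic_paths (- K) p p'"
proof -
  have Mpos: "M > 0" using assms(1)[of "\<kappa> 0"] r_pos by (smt (verit) norm_ge_zero rangeI)
  define c where "c = (\<lambda>x::real^3. (M / max M (norm x)) *\<^sub>R x)"
  have c_in: "c x = x" if "norm x \<le> M" for x using that Mpos by (simp add: c_def max_def)
  have c_norm: "norm (c x) \<le> M" for x
    using Mpos by (simp add: c_def field_simps max_def)
  have cc: "continuous_on UNIV c"
    unfolding c_def using Mpos by (intro continuous_intros) (auto simp: max_def)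
  have cE: "c x \<in> knot_exterior \<kappa> r \<inter> cball 0 M" if "x \<in> knot_exterior \<kappa> r" for x
  proof (cases "norm x \<le> M")
    case True then show ?thesis using that by (simp add: c_in)
  next
    case False
    then have n: "norm (c x) = M" using Mpos by (auto simp: c_def max_def)
    obtain y where y: "y \<in> K" "dist (c x) y = dK (c x)" using foot by blast
    have "r < M - norm y" using assms(1)[OF y(1)] by simp
    also have "\<dots> \<le> dist (c x) y" using norm_triangle_ineq2[of "c x" y] n by (simp add: dist_norm)
    finally show ?thesis using y(2) c_norm by (simp add: exterior_eq)
  qed
  have seg: "closed_segment x (c x) \<subseteq> - K" if "x \<in> knot_exterior \<kappa> r" for x
  proof (cases "norm x \<le> M")
    case True
    then show ?thesis using that r_pos dK_eq_0_iff[of x] by (simp add: c_in exterior_eq)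
  next
    case False
    show ?thesis
    proof (rule subsetI, rule ComplI)
      fix w assume "w \<in> closed_segment x (c x)" "w \<in> K"
      then obtain u where u: "0 \<le> u" "u \<le> 1" "w = (1 - u) *\<^sub>R x + u *\<^sub>R c x"
        by (auto simp: closed_segment_def)
      have "w = ((1 - u) + u * (M / norm x)) *\<^sub>R x"
        using False by (simp add: u(3) c_def max_def algebra_simps)
      then have "norm w = \<bar>(1 - u) + u * (M / norm x)\<bar> * norm x" by simp
      also have "\<bar>(1 - u) + u * (M / norm x)\<bar> = (1 - u) + u * (M / norm x)"
        using u Mpos by (intro abs_of_nonneg add_nonneg_nonneg mult_nonneg_nonneg divide_nonneg_nonneg) auto
      also have "\<dots> * norm x = (1 - u) * norm x + u * M"
      proof -
        have "norm x \<noteq> 0" using False Mpos by auto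
        then show ?thesis by (simp add: field_simps)
      qed
      also have "\<dots> \<ge> (1 - u) * M + u * M"
        using False u by (intro add_right_mono mult_left_mono) auto
      finally have "norm w \<ge> M" by (simp add: algebra_simps)
      then show False using assms(1)[OF \<open>w \<in> K\<close>] r_pos by simp
    qed
  qed
  have p': "path_in (knot_exterior \<kappa> r \<inter> cball 0 M) b b (c \<circ> p)"
    using path_in_image[OF p continuous_on_subset[OF cc subset_UNIV], of "knot_exterior \<kappa> r \<inter> cball 0 M"] cE c_in[OF M] by auto
  moreover have "homotopic_paths (- K) p (c \<circ> p)"
  proof (rule homotopic_paths_linear)
    fix s :: real assume "s \<in> {0..1}"
    then have "p s \<in> knot_exterior \<kappa> r" using p unfolding path_in_def path_image_def by blast
    then show "closed_segment (p s) ((c \<circ> p) s) \<subseteq> - K" using seg by simp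
  qed (use p p' in \<open>auto simp: path_in_def\<close>)
  ultimately show ?thesis by blast
qed

lemma compact_exterior_ball: "compact (knot_exterior \<kappa> r \<inter> cball 0 M)"
  unfolding knot_exterior_def by (intro closed_Int_compact closed_closure compact_cball)

lemma pushoff_in_exterior:
  assumes "norm v = 1" "v \<bullet> T t = 0" shows "\<kappa> t + r *\<^sub>R v \<in> knot_exterior \<kappa> r"
  using dK_normal_disk[of "r *\<^sub>R v" t] assms r_pos R_gt by (simp add: exterior_eq)

lemma meridian_loop_path: "path_in (knot_exterior \<kappa> r) (\<kappa> 0 + r *\<^sub>R \<nu> 0) (\<kappa> 0 + r *\<^sub>R \<nu> 0) (meridian_loop \<kappa> r (\<nu> 0))"
proof -
  let ?m = "(0, of_real (ln r)) :: real \<times> complex"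
  have "path (tube_map \<circ> linepath ?m (?m + turn 1))"
    by (intro path_continuous_image path_linepath continuous_tube_map)
  then have "path (meridian_loop \<kappa> r (\<nu> 0))" by (simp only: meridian_loop_eq)
  moreover have "meridian_loop \<kappa> r (\<nu> 0) s \<in> knot_exterior \<kappa> r" for s
    unfolding meridian_loop_def
  proof (rule pushoff_in_exterior)
    show "norm (cos (2 * pi * s) *\<^sub>R \<nu> 0 + sin (2 * pi * s) *\<^sub>R cross3 (T 0) (\<nu> 0)) = 1"
      unfolding norm_frame_combination[OF norm_tangent frame] by (simp add: cmod_def)
    show "(cos (2 * pi * s) *\<^sub>R \<nu> 0 + sin (2 * pi * s) *\<^sub>R cross3 (T 0) (\<nu> 0)) \<bullet> T 0 = 0"
      using frame(2) by (simp add: inner_add_left dot_cross_self)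
  qed
  ultimately show ?thesis
    by (auto simp: path_in_def path_image_def) (simp_all add: pathstart_def pathfinish_def meridian_loop_def)
qed

text \<open>Modulo the normal closure of the meridian, the class of a path is a holonomy that kills the
  meridian, hence all small loops and then all loops. So the conjugates of the meridian generate, and since the group is finitely
  generated, finitely many of them suffice.\<close>

theorem knot_group_generated_by_meridians:
  defines "G \<equiv> knot_group \<kappa> r (\<nu> 0)" and "m \<equiv> meridian \<kappa> r (\<nu> 0)"
  shows "group G" "m \<in> carrier G"
    and "\<exists>A. finite A \<and> A \<subseteq> carrier G \<and> carrier G = generate G ((\<lambda>g. g \<otimes>\<^bsub>G\<^esub> m \<otimes>\<^bsub>G\<^esub> inv\<^bsub>G\<^esub> g) ` A)"
proof -
  let ?E = "knot_exterior \<kappa> r" and ?b = "\<kappa> 0 + r *\<^sub>R \<nu> 0"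
  have G: "G = fundamental_group ?E ?b" by (simp add: G_def knot_group_def)
  have bE: "?b \<in> ?E" by (rule pushoff_in_exterior[OF frame])
  have EC: "?E \<subseteq> - K" using r_pos dK_eq_0_iff by (fastforce simp: exterior_eq)
  interpret group G unfolding G by (rule group_fundamental_group[OF bE])
  show "group G" ..
  show mG: "m \<in> carrier G"
    unfolding m_def meridian_def G by (rule loop_class_in_group[OF meridian_loop_path])
  obtain \<phi> where hol: "holonomy G (- K) \<phi>" and \<phi>: "\<And>p. path_in ?E ?b ?b p \<Longrightarrow> \<phi> p = loop_class ?E p"
    using retraction_holonomy[OF EC retraction_exterior bE path_connected_complement] unfolding G by blast
  interpret holonomy G "- K" \<phi> by (rule hol)
  have open_C: "open (- K)" using closed_knot by (rule open_Compl)

  define N where "N = generate G ((\<lambda>g. g \<otimes>\<^bsub>G\<^esub> m \<otimes>\<^bsub>G\<^esub> inv\<^bsub>G\<^esub> g) ` carrier G)"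
  interpret N: normal N G unfolding N_def by (rule normal_closure[OF mG])
  have "m = \<one>\<^bsub>G\<^esub> \<otimes>\<^bsub>G\<^esub> m \<otimes>\<^bsub>G\<^esub> inv\<^bsub>G\<^esub> \<one>\<^bsub>G\<^esub>" using mG by simp
  then have mN: "m \<in> N" unfolding N_def by (intro generate.incl) blast
  let ?\<phi> = "\<lambda>p. N #>\<^bsub>G\<^esub> \<phi> p"
  have hol': "holonomy (G Mod N) (- K) ?\<phi>" by (rule quotient_holonomy[OF N.normal_axioms])
  have "?\<phi> (meridian_loop \<kappa> r (\<nu> 0)) = \<one>\<^bsub>G Mod N\<^esub>"
    using \<phi>[OF meridian_loop_path] mN N.subgroup_axioms coset_join2[OF mG N.subgroup_axioms mN]
    by (simp add: m_def meridian_def FactGroup_def)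
  then obtain \<epsilon> where \<epsilon>: "\<epsilon> > 0" "\<And>y. holonomy.trivial_on (G Mod N) (- K) ?\<phi> (ball y \<epsilon>)"
    using small_loops_trivial[OF hol'] by blast
  have all: "carrier G \<subseteq> N"
  proof
    fix x assume x: "x \<in> carrier G"
    then obtain p where p: "path_in ?E ?b ?b p" "x = loop_class ?E p"
      unfolding G carrier_fundamental_group by blast
    have "?\<phi> p = \<one>\<^bsub>G Mod N\<^esub>"
      by (rule holonomy.trivial_if_locally_trivial[OF hol' open_C generic_point \<epsilon> path_in_mono[OF p(1) EC]])
    then have "N #>\<^bsub>G\<^esub> x = N" using \<phi>[OF p(1)] p(2) by (simp add: FactGroup_def)
    then show "x \<in> N" using coset_join1[OF _ x N.subgroup_axioms] by blast
  qed

  obtain M where M: "\<And>y. y \<in> insert ?b K \<Longrightarrow> norm y + r < M"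
  proof -
    have "bounded (insert ?b K)" using compact_imp_bounded[OF compact_knot] by simp
    then obtain B where "\<And>y. y \<in> insert ?b K \<Longrightarrow> norm y \<le> B" unfolding bounded_iff by blast
    then have "norm y + r < B + r + 1" if "y \<in> insert ?b K" for y
      using that by (meson add_le_cancel_right le_less_trans less_add_one)
    with that show ?thesis by blast
  qed
  let ?A = "?E \<inter> cball 0 M"
  have "?A \<subseteq> - K" using EC by blast
  then obtain X where X: "finite X" "X \<subseteq> carrier G" "\<And>p. path_in ?A ?b ?b p \<Longrightarrow> \<phi> p \<in> generate G X"
    using finitely_generated_on_compact[OF open_C compact_exterior_ball, of M ?b] by blast
  have "x \<in> generate G X" if x: "x \<in> carrier G" for x
  proof -
    obtain p where p: "path_in ?E ?b ?b p" "x = loop_class ?E p"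
      using x unfolding G carrier_fundamental_group by blast
    have bM: "norm ?b \<le> M" using M[of ?b] r_pos by simp
    obtain p' where p': "path_in ?A ?b ?b p'" "homotopic_paths (- K) p p'"
      using push_into_ball[OF _ bM p(1)] M by blast
    have "x = \<phi> p'" using \<phi>[OF p(1)] p(2) homotopic[OF p'(2)] by simp
    then show ?thesis using X(3)[OF p'(1)] by simp
  qed
  then have CX: "carrier G = generate G X" using generate_incl[OF X(2)] by (intro equalityI subsetI) auto
  obtain A where A: "finite A" "A \<subseteq> carrier G"
    "carrier G = generate G ((\<lambda>g. g \<otimes>\<^bsub>G\<^esub> m \<otimes>\<^bsub>G\<^esub> inv\<^bsub>G\<^esub> g) ` A)"
    by (rule finitely_many_conjugates[OF mG X(1) CX all[unfolded N_def]])
  show "\<exists>A. finite A \<and> A \<subseteq> carrier G \<and> carrier G = generate G ((\<lambda>g. g \<otimes>\<^bsub>G\<^esub> m \<otimes>\<^bsub>G\<^esub> inv\<^bsub>G\<^esub> g) ` A)"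
    by (rule exI[of _ A]) (intro conjI A)
qed

end

section \<open>Augmentations and irreducible representations of the knot group\<close>

theorem theorem1p2:
  fixes \<kappa> :: "real \<Rightarrow> real^3" and r :: real and v0 :: "real^3"
    and l :: "(real \<Rightarrow> real^3) set"
    and \<epsilon> :: "(real \<Rightarrow> real^3) set free_elt set \<Rightarrow> 'f::field"
  defines "G \<equiv> knot_group \<kappa> r v0" and "m \<equiv> meridian \<kappa> r v0"
  assumes knot: "oriented_knot \<kappa>"
    and nbhd: "tube_radius \<kappa> r"
    and base: "unit_normal \<kappa> 0 v0"
    and long: "preferred_longitude \<kappa> r v0 l"
    and aug: "augmentation G m l \<epsilon>"
    and mu_ne: "\<epsilon> (cord_scalar G m l mu) \<noteq> 1"
  shows "KCH_irrep G m fun_scale (aug_space G m l \<epsilon>) (aug_rep G m l \<epsilon>)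
    \<and> induces G m l fun_scale (aug_space G m l \<epsilon>) (aug_rep G m l \<epsilon>) \<epsilon>
    \<and> (\<forall>(sc' :: 'f \<Rightarrow> 'v::ab_group_add \<Rightarrow> 'v) V' \<rho>'.
          KCH_irrep G m sc' V' \<rho>' \<and> induces G m l sc' V' \<rho>' \<epsilon>
          \<longrightarrow> rep_isomorphic G sc' V' \<rho>' fun_scale (aug_space G m l \<epsilon>) (aug_rep G m l \<epsilon>))"
proof -
  obtain \<nu> where \<nu>: "continuous_on UNIV \<nu>" "\<And>t. \<nu> (t + 1) = \<nu> t" "\<And>t. unit_normal \<kappa> t (\<nu> t)" "\<nu> 0 = v0"
    and l: "l = loop_class (knot_exterior \<kappa> r) (\<lambda>t. \<kappa> t + r *\<^sub>R \<nu> t)"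
    using long unfolding preferred_longitude_def by blast
  interpret framed_knot_tube \<kappa> r \<nu>
    by unfold_locales (rule knot, rule nbhd, rule \<nu>(1), rule \<nu>(3))
  have G: "group G" and m: "m \<in> carrier G"
    and gen: "\<exists>A. finite A \<and> A \<subseteq> carrier G
      \<and> carrier G = generate G ((\<lambda>g. g \<otimes>\<^bsub>G\<^esub> m \<otimes>\<^bsub>G\<^esub> inv\<^bsub>G\<^esub> g) ` A)"
    using knot_group_generated_by_meridians unfolding \<nu>(4) G_def m_def by blast+
  have "path_in (knot_exterior \<kappa> r) (\<kappa> 0 + r *\<^sub>R v0) (\<kappa> 0 + r *\<^sub>R v0) (\<lambda>t. \<kappa> t + r *\<^sub>R \<nu> t)"
    unfolding path_in_def
  proof (intro conjI)
    show "path (\<lambda>t. \<kappa> t + r *\<^sub>R \<nu> t)"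
      unfolding path_def
      by (intro continuous_intros continuous_knot continuous_on_subset[OF \<nu>(1)]) simp
    show "path_image (\<lambda>t. \<kappa> t + r *\<^sub>R \<nu> t) \<subseteq> knot_exterior \<kappa> r"
      unfolding path_image_def using pushoff_in_exterior[OF frame] by blast
    show "pathstart (\<lambda>t. \<kappa> t + r *\<^sub>R \<nu> t) = \<kappa> 0 + r *\<^sub>R v0"
      by (simp add: pathstart_def \<nu>(4))
    show "pathfinish (\<lambda>t. \<kappa> t + r *\<^sub>R \<nu> t) = \<kappa> 0 + r *\<^sub>R v0"
      using periodic[of 0 1] \<nu>(2)[of 0] by (simp add: pathfinish_def \<nu>(4))
  qed
  then have "l \<in> carrier G"
    unfolding l G_def knot_group_def by (rule loop_class_in_group)
  then interpret cord_augmentation G m l \<epsilon>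
    using G m aug mu_ne by (intro cord_augmentation.intro cord_augmentation_axioms.intro)
  obtain A where A: "finite A" "A \<subseteq> carrier G"
    "carrier G = generate G ((\<lambda>g. g \<otimes>\<^bsub>G\<^esub> m \<otimes>\<^bsub>G\<^esub> inv\<^bsub>G\<^esub> g) ` A)"
    using gen by (elim exE conjE)
  show ?thesis
  proof (intro conjI allI impI)
    show "KCH_irrep G m fun_scale V (aug_rep G m l \<epsilon>)" by (rule augmentation_to_irrep(1)[OF A])
    show "induces G m l fun_scale V (aug_rep G m l \<epsilon>) \<epsilon>" by (rule augmentation_to_irrep(2)[OF A])
    fix sc' :: "'f \<Rightarrow> 'v \<Rightarrow> 'v" and V' \<rho>'
    assume "KCH_irrep G m sc' V' \<rho>' \<and> induces G m l sc' V' \<rho>' \<epsilon>"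
    then show "rep_isomorphic G sc' V' \<rho>' fun_scale V (aug_rep G m l \<epsilon>)"
      by (elim conjE) (rule inducing_irrep_isomorphic)
  qed
qed

end
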